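(* Let $r\geq 4$ be a fixed integer. Then, as $n\rightarrow\infty$, $$B(K(n,r)) = \binom{n}{r} - \frac{1}{2}\binom{n-1}{r-1} - 2\frac{n^{r-2}}{(r-2)!} + (r+2)\frac{n^{r-3}}{(r-3)!} + O(n^{r-4}),$$ where the implied constant in $O(n^{r-4})$ may depend on $r$ but not on $n$.
   Context: For a graph $G=(V,E)$ on $N$ vertices and a bijection $f:V\to\{1,\dots,N\}$, let $\mathrm{dilation}(f)=\max\{|f(v)-f(w)| : vw\in E\}$. The bandwidth $B(G)$ is the minimum of $\mathrm{dilation}(f)$ over all such bijections $f$. For integers $n\ge r\ge 1$, the Kneser graph $K(n,r)$ has as vertex set the family of all $r$-element subsets of $[n]=\{1,\dots,n\}$, two vertices being adjacent iff the corresponding $r$-sets are disjoint. *)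

theory Defs
  imports
    Complex_Main
    "HOL-Library.Landau_Symbols"
    "Graph_Theory.Pair_Digraph"
begin

text \<open>
  A simple graph is a symmetric, loop-free \<^typ>\<open>'a pair_pre_digraph\<close> (locale
  \<^locale>\<open>pair_graph\<close>): each edge \<open>vw\<close> is represented by the two arcs
  \<open>(v, w)\<close> and \<open>(w, v)\<close>.
\<close>

text \<open>
  The inserted \<open>0\<close> only matters for edgeless graphs, whose dilation is taken to be \<open>0\<close>.
\<close>

definition dilation :: "'a pair_pre_digraph \<Rightarrow> ('a \<Rightarrow> nat) \<Rightarrow> nat" where
  "dilation G f = Max (insert 0 {nat \<bar>int (f v) - int (f w)\<bar> | v w. (v, w) \<in> parcs G})"

text \<open>
  For a graph with finitely many vertices the infimum below is a minimum;
  see \<open>bandwidth_attained\<close> and \<open>bandwidth_le\<close>.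
\<close>

definition bandwidth :: "'a pair_pre_digraph \<Rightarrow> nat" where
  "bandwidth G = Inf {dilation G f | f. bij_betw f (pverts G) {1..card (pverts G)}}"

definition kneser :: "nat \<Rightarrow> nat \<Rightarrow> nat set pair_pre_digraph" where
  "kneser n r =
    (let V = {A. A \<subseteq> {1..n} \<and> card A = r}
     in \<lparr>pverts = V, parcs = {(A, B). A \<in> V \<and> B \<in> V \<and> A \<inter> B = {}}\<rparr>)"

lemma bandwidth_attained:
  assumes "finite (pverts G)"
  shows "\<exists>f. bij_betw f (pverts G) {1..card (pverts G)} \<and> bandwidth G = dilation G f"
proof -
  let ?D = "{dilation G f | f. bij_betw f (pverts G) {1..card (pverts G)}}"
  obtain f where "bij_betw f (pverts G) {1..card (pverts G)}"
    using finite_same_card_bij[OF assms, of "{1..card (pverts G)}"] by auto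
  hence "?D \<noteq> {}" by blast
  hence "Inf ?D \<in> ?D" by (rule Inf_nat_def1)
  thus ?thesis by (auto simp: bandwidth_def)
qed

lemma bandwidth_le:
  assumes "bij_betw f (pverts G) {1..card (pverts G)}"
  shows "bandwidth G \<le> dilation G f"
  unfolding bandwidth_def by (rule wellorder_Inf_le1) (use assms in blast)

lemma pair_graph_kneser:
  assumes "r \<ge> 1"
  shows "pair_graph (kneser n r)"
proof -
  define V where "V = {A. A \<subseteq> {1..n} \<and> card A = r}"
  have G: "pverts (kneser n r) = V"
    "parcs (kneser n r) = {(A, B). A \<in> V \<and> B \<in> V \<and> A \<inter> B = {}}"
    unfolding kneser_def Let_def V_def by (rule pair_pre_digraph.simps)+
  have "V \<subseteq> Pow {1..n}" unfolding V_def by blast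
  hence V: "finite (pverts (kneser n r))"
    unfolding G by (rule finite_subset) simp
  have E: "parcs (kneser n r) \<subseteq> pverts (kneser n r) \<times> pverts (kneser n r)"
    unfolding G by blast
  have S: "sym (parcs (kneser n r))"
    unfolding G by (rule symI) blast
  have "{} \<notin> V" using assms unfolding V_def by simp
  hence L: "fst e \<noteq> snd e" if "e \<in> parcs (kneser n r)" for e
    using that unfolding G by (cases e) force
  have W: "pair_wf_digraph (kneser n r)"
    unfolding pair_wf_digraph_def G by (simp add: split_beta)
  have F: "finite (parcs (kneser n r))"
    by (rule finite_subset[OF E]) (simp add: V)
  show ?thesis
    using V S L W F
    by (simp add: pair_graph_def pair_digraph_def pair_pseudo_graph_def pair_fin_digraph_def
        pair_fin_digraph_axioms_def pair_loopfree_digraph_def pair_loopfree_digraph_axioms_def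
        pair_sym_digraph_def pair_sym_digraph_axioms_def symmetric_def)
qed

end

theory Submission
  imports Defs
begin

text \<open>
  An arrangement of dilation \<open>D\<close> amounts to sequences \<open>A\<^sub>i\<close> (from the front) and \<open>B\<^sub>j\<close> (from the back)
  such that \<open>A\<^sub>i\<close> meets \<open>B\<^sub>j\<close> whenever \<open>i + j \<le> k\<close>, where \<open>k = N - D\<close>; so \<open>k\<close> is to be maximised.
  Large cross-intersecting families form a star, hence all \<open>A\<^sub>i\<close> and \<open>B\<^sub>i\<close> but the last few contain
  a common point \<open>x\<close>, and \<open>2 (k - 1)\<close> exceeds the size \<open>binom (n - 1) (r - 1)\<close> of this star by at most
  the number of late sets avoiding \<open>x\<close>. Those at the end of \<open>A\<close> must meet the first \<open>B\<^sub>j\<close>: up to lower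
  order terms they contain two points \<open>y\<close>, \<open>z\<close>, one of which lies in each of the first \<open>B\<^sub>j\<close>, and there
  are about \<open>2 n\<^sup>r\<^sup>-\<^sup>3 / (r - 3)!\<close> exceptional \<open>B\<^sub>j\<close>. The same holds with \<open>A\<close> and \<open>B\<close> exchanged and
  points \<open>u\<close>, \<open>v\<close>. As the \<open>A\<^sub>i\<close> and \<open>B\<^sub>j\<close> are distinct, the number of late sets is at most the number of
  sets containing \<open>x\<close> and meeting \<open>{y, z, u, v}\<close>, plus the exceptions. Conversely, an arrangement
  built from these extremal configurations attains the bound up to \<open>O(n\<^sup>r\<^sup>-\<^sup>4)\<close>.
\<close>

section \<open>Cross-intersecting families\<close>

lemma card_subsets_between:
  assumes X: "finite X" "P \<subseteq> X" "Q \<subseteq> X" "P \<inter> Q = {}" and r: "card P \<le> r"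
  shows "card {A. A \<subseteq> X \<and> card A = r \<and> P \<subseteq> A \<and> A \<inter> Q = {}} =
    (card X - card P - card Q) choose (r - card P)"
proof -
  let ?Y = "X - P - Q"
  have fin: "finite P" "finite Q" "finite ?Y" using X by (simp_all add: finite_subset)
  have "bij_betw (\<lambda>B. B \<union> P) {B. B \<subseteq> ?Y \<and> card B = r - card P}
      {A. A \<subseteq> X \<and> card A = r \<and> P \<subseteq> A \<and> A \<inter> Q = {}}"
  proof (rule bij_betwI[where g = "\<lambda>A. A - P"], goal_cases)
    case 1
    have "card (B \<union> P) = r" if "B \<subseteq> ?Y" "card B = r - card P" for B
    proof -
      have "finite B" "B \<inter> P = {}" using that finite_subset[OF that(1) fin(3)] by auto
      then show ?thesis using card_Un_disjoint[of B P] fin(1) that(2) r by linarith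
    qed
    then show ?case using X(2,4) by (intro Pi_I) blast
  next
    case 2
    then show ?case using X(4) fin(1) by (auto simp: card_Diff_subset)
  qed blast+
  from bij_betw_same_card[OF this]
  have "card {A. A \<subseteq> X \<and> card A = r \<and> P \<subseteq> A \<and> A \<inter> Q = {}} = card ?Y choose (r - card P)"
    using n_subsets[OF fin(3)] by simp
  moreover have "card ?Y = card X - card P - card Q"
  proof -
    have "Q \<subseteq> X - P" using X by auto
    then show ?thesis using X fin by (simp add: card_Diff_subset)
  qed
  ultimately show ?thesis by simp
qed

lemma choose_le_pow: "m \<le> n \<Longrightarrow> m choose j \<le> n ^ j"
  by (cases "j \<le> m") (auto intro: order_trans[OF binomial_le_pow] power_mono simp: binomial_eq_0)

lemma card_supersets_le:
  assumes "finite X" "\<G> \<subseteq> {G. G \<subseteq> X \<and> card G = b \<and> P \<subseteq> G}" "finite P" "card P \<le> b"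
  shows "card \<G> \<le> (card X - card P) choose (b - card P)"
proof (cases "P \<subseteq> X")
  case True
  have "finite {G. G \<subseteq> X \<and> card G = b \<and> P \<subseteq> G}"
    by (rule finite_subset[of _ "Pow X"]) (use assms(1) in auto)
  from card_mono[OF this assms(2)] show ?thesis
    using card_subsets_between[of X P "{}" b] assms True by simp
next
  case False
  then have "\<G> = {}" using assms(2) by blast
  then show ?thesis by simp
qed

text \<open>A member contains \<open>y\<close> and must hit \<open>F\<close> in a point other than
  \<open>y\<close>, so it contains one of at most \<open>a\<close> pairs; each pair lies in at most
  \<open>card X ^ (b - 2)\<close> sets of size \<open>b\<close>.\<close>

lemma card_star_meeting_le:
  assumes X: "finite X" "\<G> \<subseteq> {G. G \<subseteq> X \<and> card G = b}" and b: "2 \<le> b"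
    and y: "\<And>G. G \<in> \<G> \<Longrightarrow> y \<in> G"
    and F: "finite F" "card F \<le> a" "y \<notin> F" "\<And>G. G \<in> \<G> \<Longrightarrow> G \<inter> F \<noteq> {}"
  shows "card \<G> \<le> a * card X ^ (b - 2)"
proof -
  have fin: "finite \<G>" by (rule finite_subset[of _ "Pow X"]) (use X in auto)
  have "card {G \<in> \<G>. z \<in> G} \<le> card X ^ (b - 2)" if "z \<in> F" for z
  proof -
    have yz: "y \<noteq> z" using that F by auto
    have "card {G \<in> \<G>. z \<in> G} \<le> (card X - card {y, z}) choose (b - card {y, z})"
      using X y b yz by (intro card_supersets_le) auto
    also have "\<dots> \<le> card X ^ (b - 2)" using yz by (simp add: choose_le_pow numeral_2_eq_2)
    finally show ?thesis .
  qed
  moreover have "\<G> = (\<Union>z\<in>F. {G \<in> \<G>. z \<in> G})" using F by blast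
  then have "card \<G> \<le> (\<Sum>z\<in>F. card {G \<in> \<G>. z \<in> G})"
    using card_UN_le[OF F(1), of "\<lambda>z. {G \<in> \<G>. z \<in> G}"] by simp
  ultimately have "card \<G> \<le> card F * card X ^ (b - 2)"
    using sum_bounded_above[of F "\<lambda>z. card {G \<in> \<G>. z \<in> G}" "card X ^ (b - 2)"] by simp
  then show ?thesis using F(2) by (meson mult_le_mono1 order_trans)
qed

section \<open>Common points forced by large cross-intersecting families\<close>

definition cross :: "'a set set \<Rightarrow> 'a set set \<Rightarrow> bool" where
  "cross \<F> \<G> \<longleftrightarrow> (\<forall>F\<in>\<F>. \<forall>G\<in>\<G>. F \<inter> G \<noteq> {})"

text \<open>Without a common point, fix one \<open>F\<close>: each \<open>G\<close> passes through
  one of its at most \<open>a\<close> points. For each such point some other member of the first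
  family misses it, so the previous lemma bounds the \<open>G\<close> through it, which costs a
  second factor \<open>a\<close>.\<close>

lemma common_element_of_large_cross:
  assumes X: "finite X" "\<G> \<subseteq> {G. G \<subseteq> X \<and> card G = b}" and b: "2 \<le> b"
    and F: "\<F> \<noteq> {}" "\<And>F. F \<in> \<F> \<Longrightarrow> finite F \<and> card F \<le> a"
    and "cross \<F> \<G>" and large: "a\<^sup>2 * card X ^ (b - 2) < card \<G>"
  shows "\<exists>y. \<forall>F\<in>\<F>. y \<in> F"
proof (rule ccontr)
  assume "\<nexists>y. \<forall>F\<in>\<F>. y \<in> F"
  then have none: "\<exists>F\<in>\<F>. y \<notin> F" for y by blast
  obtain F where F1: "F \<in> \<F>" using F by blast
  have fin: "finite F" "card F \<le> a" using F F1 by auto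
  have "card {G \<in> \<G>. y \<in> G} \<le> a * card X ^ (b - 2)" for y
  proof -
    obtain F' where "F' \<in> \<F>" "y \<notin> F'" using none by blast
    then show ?thesis
      using X b F \<open>cross \<F> \<G>\<close>
      by (intro card_star_meeting_le[of _ _ _ y F']) (auto simp: cross_def Int_commute)
  qed
  moreover have "\<G> = (\<Union>z\<in>F. {G \<in> \<G>. z \<in> G})" using F1 \<open>cross \<F> \<G>\<close> by (fastforce simp: cross_def)
  then have "card \<G> \<le> (\<Sum>z\<in>F. card {G \<in> \<G>. z \<in> G})"
    using card_UN_le[OF fin(1), of "\<lambda>z. {G \<in> \<G>. z \<in> G}"] by simp
  ultimately have "card \<G> \<le> card F * (a * card X ^ (b - 2))"
    using sum_bounded_above[of F "\<lambda>z. card {G \<in> \<G>. z \<in> G}" "a * card X ^ (b - 2)"] by simp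
  also have "\<dots> \<le> a * (a * card X ^ (b - 2))" using fin by simp
  finally show False using large by (simp add: power2_eq_square mult.assoc)
qed

text \<open>\<open>\<B>\<close> is large, so all of \<open>\<C>\<close> shares a point
  \<open>y\<close>. As \<open>\<B>\<close> exceeds a full star by a margin, many of its members
  avoid \<open>y\<close>; these meet the sets \<open>C - {y}\<close>, which are numerous, so they
  share a point \<open>z\<close>. A \<open>C\<close> missing \<open>z\<close> would leave too few
  sets through \<open>z\<close> that meet it, hence \<open>z\<close> also lies in all of
  \<open>\<C>\<close>.\<close>

lemma cross_pair_structure:
  assumes X: "finite X" "\<B> \<subseteq> {B. B \<subseteq> X \<and> card B = p}" "\<C> \<subseteq> {C. C \<subseteq> X \<and> card C = Suc p}"
    and p: "2 \<le> p" and "cross \<B> \<C>"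
    and B: "((card X - 1) choose (p - 1)) + (Suc p)\<^sup>2 * card X ^ (p - 2) < card \<B>"
    and C: "(Suc p)\<^sup>2 * card X ^ (p - 2) < card \<C>"
  obtains y z where "y \<noteq> z" "\<And>C. C \<in> \<C> \<Longrightarrow> y \<in> C \<and> z \<in> C" "\<And>B. B \<in> \<B> \<Longrightarrow> y \<in> B \<or> z \<in> B"
proof -
  have BC: "\<B> \<subseteq> Pow X" "\<C> \<subseteq> Pow X" using X by auto
  have "finite B" if "B \<in> \<B> \<union> \<C>" for B
    by (rule finite_subset[OF _ X(1)]) (use that BC in blast)
  with BC X(1) have fin: "finite \<B>" "finite \<C>" "\<And>B. B \<in> \<B> \<Longrightarrow> finite B" "\<And>C. C \<in> \<C> \<Longrightarrow> finite C"
    by (simp_all add: finite_subset)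
  have "\<C> \<noteq> {}" "cross \<C> \<B>" using C \<open>cross \<B> \<C>\<close> by (auto simp: cross_def Int_commute)
  moreover have "finite C \<and> card C \<le> Suc p" if "C \<in> \<C>" for C using that fin(4)[of C] X(3) by (simp add: subset_iff)
  moreover have "(Suc p)\<^sup>2 * card X ^ (p - 2) < card \<B>" using B by simp
  ultimately obtain y where y: "\<And>C. C \<in> \<C> \<Longrightarrow> y \<in> C"
    using common_element_of_large_cross[OF X(1,2) p] by metis
  let ?B = "{B \<in> \<B>. y \<notin> B}" and ?C = "(\<lambda>C. C - {y}) ` \<C>"
  have "card {B \<in> \<B>. y \<in> B} \<le> (card X - card {y}) choose (p - card {y})"
    using X p by (intro card_supersets_le) auto
  moreover have "card \<B> = card {B \<in> \<B>. y \<in> B} + card ?B"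
    using fin card_Int_Diff[of \<B> "{B. y \<in> B}"] by (simp add: Int_def set_diff_eq)
  ultimately have B': "(Suc p)\<^sup>2 * card X ^ (p - 2) < card ?B" using B by simp
  have "inj_on (\<lambda>C. C - {y}) \<C>" by (rule inj_onI) (metis insert_Diff y)
  then have "card ?C = card \<C>" by (rule card_image)
  moreover have "p\<^sup>2 * card X ^ (p - 2) \<le> (Suc p)\<^sup>2 * card X ^ (p - 2)"
    by (intro mult_right_mono power_mono) auto
  ultimately have C': "p\<^sup>2 * card X ^ (p - 2) < card ?C" using C by linarith
  have "?B \<noteq> {}" using B' by (metis card.empty not_less_zero)
  have sub: "?C \<subseteq> {C. C \<subseteq> X \<and> card C = p}" 
  proof
    fix C' assume "C' \<in> ?C"
    then obtain C where C': "C' = C - {y}" and "C \<in> \<C>" by (rule imageE)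
    then have "C \<subseteq> X" "card C = Suc p" "y \<in> C" using X(3) y by (simp_all add: subset_iff)
    then show "C' \<in> {C. C \<subseteq> X \<and> card C = p}"
      unfolding C' mem_Collect_eq by (simp add: card_Diff_singleton subset_iff)
  qed
  have "finite B \<and> card B \<le> p" if "B \<in> ?B" for B using that X(2) fin(3)[of B] by (simp add: subset_iff)
  note common = common_element_of_large_cross[OF X(1) sub p \<open>?B \<noteq> {}\<close> this]
  have cr: "cross ?B ?C" using \<open>cross \<B> \<C>\<close> unfolding cross_def by blast
  have "\<exists>z. \<forall>B\<in>?B. z \<in> B" by (rule common[OF _ cr C'])
  then obtain z where z: "\<And>B. B \<in> ?B \<Longrightarrow> z \<in> B" by blast
  have yz: "y \<noteq> z" using \<open>?B \<noteq> {}\<close> z by blast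
  have zC: "z \<in> C" if "C \<in> \<C>" for C
  proof (rule ccontr)
    assume "z \<notin> C"
    have "card ?B \<le> Suc p * card X ^ (p - 2)"
    proof (rule card_star_meeting_le[OF X(1) _ p])
      show "?B \<subseteq> {B. B \<subseteq> X \<and> card B = p}" using X(2) by blast
      show "finite C" "card C \<le> Suc p" using that X(3) fin(4) by (simp_all add: subset_iff)
      show "B \<inter> C \<noteq> {}" if "B \<in> ?B" for B
        using that \<open>C \<in> \<C>\<close> \<open>cross \<B> \<C>\<close> unfolding cross_def by blast
    qed (use z \<open>z \<notin> C\<close> in blast)+
    also have "\<dots> \<le> (Suc p)\<^sup>2 * card X ^ (p - 2)" by (simp add: power2_eq_square)
    finally show False using B' by simp
  qed
  show ?thesis by (rule that[OF yz]) (use y z zC in blast)+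
qed

section \<open>Upper bound for the overlap of the two ends\<close>

text \<open>The assumptions are symmetric in \<open>A\<close> and \<open>B\<close>, so each result
  is also available with the two ends exchanged. Positive indices with \<open>i + j \<le> k\<close>
  never exceed \<open>k - 1\<close>.\<close>

locale cross_sequences =
  fixes X :: "'a set" and r k :: nat and A B :: "nat \<Rightarrow> 'a set"
  assumes finX: "finite X"
    and A: "\<And>i. i \<in> {1..<k} \<Longrightarrow> A i \<subseteq> X \<and> card (A i) = r" and injA: "inj_on A {1..<k}"
    and B: "\<And>i. i \<in> {1..<k} \<Longrightarrow> B i \<subseteq> X \<and> card (B i) = r" and injB: "inj_on B {1..<k}"
    and AB: "\<And>i j. i \<in> {1..<k} \<Longrightarrow> j \<in> {1..<k} \<Longrightarrow> A i \<noteq> B j"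
    and meet: "\<And>i j. 1 \<le> i \<Longrightarrow> 1 \<le> j \<Longrightarrow> i + j \<le> k \<Longrightarrow> A i \<inter> B j \<noteq> {}"
begin

lemma swapped: "cross_sequences X r k B A"
proof
  show "B i \<inter> A j \<noteq> {}" if "1 \<le> i" "1 \<le> j" "i + j \<le> k" for i j
    using meet[of j i] that by (simp add: Int_commute add.commute)
  show "B i \<noteq> A j" if "i \<in> {1..<k}" "j \<in> {1..<k}" for i j
    using AB[of j i] that by metis
qed (fact finX A injA B injB)+

text \<open>The condition \<open>i + j \<le> k\<close> makes each member meet all of
  \<open>B 1\<close>, ..., \<open>B j\<close>. Raising \<open>j\<close> imposes more sets to meet
  and discards at most one further index per step.\<close>

definition late :: "'a \<Rightarrow> nat \<Rightarrow> 'a set set" where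
  "late x j = A ` {i \<in> {1..<k}. i + j \<le> k \<and> x \<notin> A i}"

lemma card_late:
  assumes "1 \<le> j"
  shows "card {i \<in> {1..<k}. x \<notin> A i} \<le> card (late x j) + (j - 1)"
proof -
  let ?I = "{i \<in> {1..<k}. i + j \<le> k \<and> x \<notin> A i}"
  have "{i \<in> {1..<k}. x \<notin> A i} \<subseteq> ?I \<union> {k - (j - 1)..<k}" by auto
  then have "card {i \<in> {1..<k}. x \<notin> A i} \<le> card (?I \<union> {k - (j - 1)..<k})"
    by (intro card_mono) auto
  also have "\<dots> \<le> card ?I + card {k - (j - 1)..<k}" by (rule card_Un_le)
  also have "card {k - (j - 1)..<k} \<le> j - 1" by simp
  also have "inj_on A ?I" using injA by (rule inj_on_subset) auto
  then have "card ?I = card (late x j)" unfolding late_def by (simp add: card_image)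
  finally show ?thesis by simp
qed

lemma late_antimono: "i \<le> j \<Longrightarrow> late x j \<subseteq> late x i"
  unfolding late_def by (rule image_mono) auto

lemma lateD: "C \<in> late x j \<Longrightarrow> C \<subseteq> X \<and> card C = r \<and> x \<notin> C"
  unfolding late_def using A by blast

lemma late_meets:
  assumes "C \<in> late x j" "1 \<le> i" "i \<le> j"
  shows "C \<inter> B i \<noteq> {}"
  using assms meet unfolding late_def by fastforce

text \<open>
  The late \<open>A i\<close> avoiding \<open>x\<close> have to meet the early \<open>B j\<close>. Once the latter outnumber the sets through
  two given points, \<open>cross_pair_structure\<close> forces two further points \<open>y\<close>, \<open>z\<close>; the \<open>B j\<close> avoiding
  both are bounded by the same lemma with the roles of the two sides exchanged.
\<close>

lemma early_structure:
  assumes r: "4 \<le> r" and xX: "x \<in> X" and n: "n = card X"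
    and star: "\<And>j. j \<in> {1..h} \<Longrightarrow> x \<in> B j" and hk: "h < k"
    and s: "s = card {i \<in> {1..<k}. x \<notin> A i}" "s \<le> h"
  shows "s \<le> 2 * ((n - 2) choose (r - 2)) + 2 * r\<^sup>2 * n ^ (r - 3)" (is ?crude)
    and "s \<le> ((n - 2) choose (r - 2)) + 2 * r\<^sup>2 * n ^ (r - 3) \<or>
      (\<exists>y\<in>X - {x}. \<exists>z\<in>X - {x}. s \<le> card {j \<in> {1..s}. y \<in> B j \<or> z \<in> B j} +
        (2 * ((n - 4) choose (r - 3)) + 2 * r\<^sup>2 * n ^ (r - 4) + 1))" (is ?fine)
proof -
  \<comment> \<open>This is the size that lets \<open>cross_pair_structure\<close> apply to
    \<open>B 1\<close>, ..., \<open>B t1\<close> with \<open>x\<close> removed: a full star of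
    \<open>(r - 1)\<close>-sets in \<open>X - {x}\<close>, the error term, and one more for
    strictness.\<close>
  define t1 where "t1 = ((n - 2) choose (r - 2)) + r\<^sup>2 * n ^ (r - 3) + 1"
  have Bj: "B j \<subseteq> X \<and> card (B j) = r \<and> x \<in> B j" if "j \<in> {1..h}" for j
    using that hk B[of j] star[of j] by simp
  have finB: "finite (B j)" if "j \<in> {1..h}" for j
    using Bj[OF that] finX finite_subset by blast
  have injx: "inj_on (\<lambda>j. B j - {x}) J" if "J \<subseteq> {1..h}" for J
  proof (rule inj_onI)
    fix i j assume ij: "i \<in> J" "j \<in> J" "B i - {x} = B j - {x}"
    then have "B i = B j" using Bj that by (metis insert_Diff subsetD)
    moreover have "i \<in> {1..<k}" "j \<in> {1..<k}" using subsetD[OF that ij(1)] subsetD[OF that ij(2)] hk by simp_all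
    ultimately show "i = j" by (rule inj_onD[OF injB])
  qed
  have pow: "(n - 1) ^ (r - 3) \<le> n ^ (r - 3)" "(n - 3) ^ (r - 4) \<le> n ^ (r - 4)"
    by (simp_all add: power_mono)
  have cardX1: "card (X - {x}) = n - 1" using xX n finX by simp
  show ?crude ?fine
  proof (atomize (full), cases "s < t1 \<or> card (late x t1) \<le> r\<^sup>2 * n ^ (r - 3)")
    case True
    have "s \<le> ((n - 2) choose (r - 2)) + 2 * r\<^sup>2 * n ^ (r - 3)"
      using True card_late[of t1 x] s(1) by (auto simp: t1_def)
    then show "?crude \<and> ?fine" by auto
  next
    case False
    then have t1s: "t1 \<le> s" and large: "r\<^sup>2 * n ^ (r - 3) < card (late x t1)" by auto
    have t1h: "{1..t1} \<subseteq> {1..h}" using t1s s(2) by auto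
    obtain y z where yz: "y \<noteq> z" "\<And>C. C \<in> late x t1 \<Longrightarrow> y \<in> C \<and> z \<in> C"
      and yzB: "\<And>B'. B' \<in> (\<lambda>j. B j - {x}) ` {1..t1} \<Longrightarrow> y \<in> B' \<or> z \<in> B'"
    proof (rule cross_pair_structure)
      show "finite (X - {x})" using finX by simp
      show "(\<lambda>j. B j - {x}) ` {1..t1} \<subseteq> {B. B \<subseteq> X - {x} \<and> card B = r - 1}"
      proof
        fix F assume "F \<in> (\<lambda>j. B j - {x}) ` {1..t1}"
        then obtain j where F: "F = B j - {x}" and "j \<in> {1..h}" using t1h by blast
        then have "B j \<subseteq> X" "card (B j) = r" "x \<in> B j" using Bj by blast+
        then show "F \<in> {B. B \<subseteq> X - {x} \<and> card B = r - 1}"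
          unfolding F by (auto simp: card_Diff_singleton)
      qed
      show "late x t1 \<subseteq> {C. C \<subseteq> X - {x} \<and> card C = Suc (r - 1)}"
        using lateD r by fastforce
      show "2 \<le> r - 1" using r by simp
      show "cross ((\<lambda>j. B j - {x}) ` {1..t1}) (late x t1)"
        unfolding cross_def
      proof (intro ballI)
        fix F C assume "F \<in> (\<lambda>j. B j - {x}) ` {1..t1}" and C: "C \<in> late x t1"
        then obtain j where "j \<in> {1..t1}" "F = B j - {x}" by blast
        then show "F \<inter> C \<noteq> {}" using late_meets[OF C, of j] lateD[OF C] by auto
      qed
      have "card ((\<lambda>j. B j - {x}) ` {1..t1}) = t1" using injx[OF t1h] by (simp add: card_image)
      moreover have "r\<^sup>2 * (n - 1) ^ (r - 3) \<le> r\<^sup>2 * n ^ (r - 3)" using pow(1) by simp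
      moreover have eq: "Suc (r - 1) = r" "r - 1 - 2 = r - 3" "r - 1 - 1 = r - 2" "n - 1 - 1 = n - 2"
        using r by simp_all
      ultimately show "(card (X - {x}) - 1 choose (r - 1 - 1)) +
          (Suc (r - 1))\<^sup>2 * card (X - {x}) ^ (r - 1 - 2) < card ((\<lambda>j. B j - {x}) ` {1..t1})"
        unfolding cardX1 eq t1_def by linarith
      show "(Suc (r - 1))\<^sup>2 * card (X - {x}) ^ (r - 1 - 2) < card (late x t1)"
        unfolding cardX1 eq using large \<open>r\<^sup>2 * (n - 1) ^ (r - 3) \<le> r\<^sup>2 * n ^ (r - 3)\<close> by linarith
    qed blast
    have "late x t1 \<noteq> {}" using large by (metis card.empty not_less_zero)
    then have yzX: "y \<in> X - {x}" "z \<in> X - {x}" using yz(2) lateD by blast+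
    \<comment> \<open>Late sets avoid \<open>x\<close> and contain both \<open>y\<close> and
      \<open>z\<close>, so they are counted by a single binomial coefficient; the at most
      \<open>t1 - 1\<close> indices discarded by \<open>late\<close> account for the second one in
      the crude bound.\<close>
    have "card (late x t1) \<le> (card (X - {x}) - card {y, z}) choose (r - card {y, z})"
      by (rule card_supersets_le) (use finX yz lateD r in \<open>auto simp: subset_iff\<close>)
    also have "\<dots> \<le> (n - 2) choose (r - 2)"
      using yz(1) unfolding cardX1 by (simp add: binomial_right_mono numeral_2_eq_2)
    finally have crude: ?crude using card_late[of t1 x] s(1) by (simp add: t1_def)

    \<comment> \<open>The analogue of \<open>t1\<close> for the exchanged roles: a full star of
      \<open>(r - 2)\<close>-sets in \<open>X - {x, y, z}\<close>, the error term, and one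
      more.\<close>
    define t2 where "t2 = ((n - 4) choose (r - 3)) + r\<^sup>2 * n ^ (r - 4) + 1"
    define Ex where "Ex = {j \<in> {1..s}. y \<notin> B j \<and> z \<notin> B j}"
    have finEx: "finite Ex" "Ex \<subseteq> {1..s}" unfolding Ex_def by auto
    have Ex_late: "t1 < j" if "j \<in> Ex" for j
    proof (rule ccontr)
      assume "\<not> t1 < j"
      then have "j \<in> {1..t1}" using that unfolding Ex_def by auto
      then show False using yzB[of "B j - {x}"] that unfolding Ex_def by blast
    qed
    have "card Ex \<le> 2 * ((n - 4) choose (r - 3)) + 2 * r\<^sup>2 * n ^ (r - 4) + 1"
    proof (cases "s < t2")
      case True
      then show ?thesis using card_mono[OF _ finEx(2)] unfolding t2_def by simp
    next
      case False
      \<comment> \<open>With this cut \<open>late x j0\<close> still has at least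
        \<open>s - (j0 - 1) = t2\<close> members, while only \<open>t2 - 1\<close> exceptional
        indices lie beyond \<open>j0\<close>.\<close>
      define j0 where "j0 = s - t2 + 1"
      define E0 where "E0 = {j \<in> Ex. j \<le> j0}"
      have "Ex \<subseteq> E0 \<union> {j0<..s}" using finEx(2) unfolding E0_def by auto
      then have "card Ex \<le> card (E0 \<union> {j0<..s})"
        by (rule card_mono[rotated]) (use finEx in \<open>simp add: E0_def\<close>)
      also have "\<dots> \<le> card E0 + card {j0<..s}" by (rule card_Un_le)
      also have "card {j0<..s} = t2 - 1" using False by (simp add: j0_def t2_def)
      finally have Ex_E0: "card Ex \<le> card E0 + (t2 - 1)" .
      have "card E0 \<le> ((n - 4) choose (r - 3)) + r\<^sup>2 * n ^ (r - 4)"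
      proof (rule ccontr)
        assume neg: "\<not> ?thesis"
        then have "E0 \<noteq> {}" by auto
        then obtain j where "j \<in> Ex" "j \<le> j0" unfolding E0_def by blast
        \<comment> \<open>Exceptional indices exceed \<open>t1\<close>, so one below the cut forces
          \<open>t1 \<le> j0\<close>, and the sets in \<open>late x j0\<close> inherit the points
          \<open>y\<close> and \<open>z\<close>.\<close>
        then have "t1 \<le> j0" using Ex_late[of j] by simp
        then have sub: "late x j0 \<subseteq> late x t1" by (rule late_antimono)
        have E0h: "E0 \<subseteq> {1..h}" using finEx s(2) unfolding E0_def by auto
        have cardX3: "card (X - {x, y, z}) = n - 3"
        proof -
          have "card {x, y, z} = 3" "{x, y, z} \<subseteq> X" using xX yzX yz(1) by auto
          then show ?thesis using n card_Diff_subset[of "{x, y, z}" X] by simp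
        qed
        have E0B: "B j - {x} \<subseteq> X - {x, y, z} \<and> card (B j - {x}) = r - 1" if "j \<in> E0" for j
        proof -
          have "j \<in> {1..h}" "y \<notin> B j" "z \<notin> B j" using that E0h unfolding E0_def Ex_def by auto
          then show ?thesis using Bj[of j] finB[of j] by (auto simp: card_Diff_singleton)
        qed
        let ?L = "(\<lambda>C. C - {y, z}) ` late x j0" and ?E = "(\<lambda>j. B j - {x}) ` E0"
        have cardE: "card ?E = card E0" using injx[OF E0h] by (rule card_image)
        have subE: "?E \<subseteq> {C. C \<subseteq> X - {x, y, z} \<and> card C = Suc (r - 2)}" using E0B r by auto
        have eq: "Suc (r - 2) = r - 1" "r - 2 - 2 = r - 4" "r - 2 - 1 = r - 3" "n - 3 - 1 = n - 4"
          using r by simp_all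
        have "(r - 1)\<^sup>2 * (n - 3) ^ (r - 4) \<le> r\<^sup>2 * n ^ (r - 4)"
          using pow(2) by (intro mult_mono power_mono) auto
        note le = this
        \<comment> \<open>Now the late sets without \<open>y\<close>, \<open>z\<close> play the part
          of \<open>\<B>\<close>, and the exceptional \<open>B j\<close> without \<open>x\<close>
          that of \<open>\<C>\<close>. Intersections survive the removals because late sets avoid
          \<open>x\<close> and exceptional sets avoid \<open>y\<close> and \<open>z\<close>. Two
          common points make the exceptional sets too few.\<close>
        obtain u v where uv: "u \<noteq> v" "\<And>C. C \<in> ?E \<Longrightarrow> u \<in> C \<and> v \<in> C"
        proof (rule cross_pair_structure)
          show "finite (X - {x, y, z})" using finX by simp
          show "?L \<subseteq> {B. B \<subseteq> X - {x, y, z} \<and> card B = r - 2}"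
          proof
            fix F assume "F \<in> ?L"
            then obtain C where F: "F = C - {y, z}" and C: "C \<in> late x j0" by blast
            then have "y \<in> C" "z \<in> C" "C \<subseteq> X" "card C = r" "x \<notin> C"
              using sub yz(2) lateD by blast+
            then show "F \<in> {B. B \<subseteq> X - {x, y, z} \<and> card B = r - 2}"
              using F yz(1) by (auto simp: card_Diff_subset)
          qed
          show "2 \<le> r - 2" using r by simp
          show "cross ?L ?E"
            unfolding cross_def
          proof (intro ballI)
            fix F G assume "F \<in> ?L" "G \<in> ?E"
            then obtain C j where F: "F = C - {y, z}" and C: "C \<in> late x j0"
              and G: "G = B j - {x}" and j: "j \<in> E0" by blast
            have "1 \<le> j" "j \<le> j0" "y \<notin> B j" "z \<notin> B j" using j unfolding E0_def Ex_def by auto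
            then show "F \<inter> G \<noteq> {}" using late_meets[OF C, of j] lateD[OF C] F G by auto
          qed
          have "inj_on (\<lambda>C. C - {y, z}) (late x j0)"
          proof (rule inj_onI)
            fix C D assume "C \<in> late x j0" "D \<in> late x j0" and eq: "C - {y, z} = D - {y, z}"
            then have "{y, z} \<subseteq> C" "{y, z} \<subseteq> D" using sub yz(2) by blast+
            then show "C = D" using eq by (metis Diff_partition)
          qed
          then have "card ?L = card (late x j0)" by (rule card_image)
          moreover have "t2 \<le> card (late x j0)"
            using card_late[of j0 x] s(1) False by (simp add: j0_def)
          ultimately show "(card (X - {x, y, z}) - 1 choose (r - 2 - 1)) +
              (Suc (r - 2))\<^sup>2 * card (X - {x, y, z}) ^ (r - 2 - 2) < card ?L"
            unfolding cardX3 eq using le by (simp add: t2_def)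
          show "(Suc (r - 2))\<^sup>2 * card (X - {x, y, z}) ^ (r - 2 - 2) < card ?E"
            unfolding cardX3 eq cardE using le neg by linarith
        qed (use subE in blast)+
        have "card ?E \<le> (card (X - {x, y, z}) - card {u, v}) choose (Suc (r - 2) - card {u, v})"
          by (rule card_supersets_le) (use finX uv subE r in \<open>auto simp: subset_iff\<close>)
        also have "\<dots> \<le> (n - 4) choose (r - 3)"
        proof -
          have "card {u, v} = 2" "Suc (r - 2) - 2 = r - 3" using uv(1) r by auto
          then show ?thesis unfolding cardX3 by (simp only:) (rule binomial_right_mono, simp)
        qed
        finally show False using neg cardE by simp
      qed
      then show ?thesis using Ex_E0 by (simp add: t2_def)
    qed
    moreover have "s \<le> card {j \<in> {1..s}. y \<in> B j \<or> z \<in> B j} + card Ex"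
    proof -
      have "{1..s} = {j \<in> {1..s}. y \<in> B j \<or> z \<in> B j} \<union> Ex" unfolding Ex_def by blast
      then show ?thesis
        using card_Un_le[of "{j \<in> {1..s}. y \<in> B j \<or> z \<in> B j}" Ex] by (metis card_atLeastAtMost diff_Suc_1)
    qed
    ultimately have "s \<le> card {j \<in> {1..s}. y \<in> B j \<or> z \<in> B j} +
        (2 * ((n - 4) choose (r - 3)) + 2 * r\<^sup>2 * n ^ (r - 4) + 1)" by linarith
    then show "?crude \<and> ?fine" using crude yzX by blast
  qed
qed

text \<open>With \<open>c = r\<^sup>2 * n ^ (r - 2)\<close> and \<open>h = k - c - 1\<close>, the
  first \<open>c + 1\<close> sets of one end meet all of the first \<open>h\<close> sets of the
  other. So the first \<open>A i\<close> share a point \<open>x\<close>; a \<open>B j\<close>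
  missing \<open>x\<close> with \<open>j \<le> h\<close> would meet too few sets through
  \<open>x\<close>, and the same argument then returns from \<open>B\<close> to
  \<open>A\<close>.\<close>

lemma common_element_early:
  assumes r: "2 \<le> r" and n: "n = card X" and k: "2 * (r\<^sup>2 * n ^ (r - 2)) + 1 < k"
  obtains x where "x \<in> X" "\<And>i. 1 \<le> i \<Longrightarrow> i + r\<^sup>2 * n ^ (r - 2) < k \<Longrightarrow> x \<in> A i \<and> x \<in> B i"
proof -
  define c where "c = r\<^sup>2 * n ^ (r - 2)"
  define h where "h = k - c - 1"
  have ch: "c < h" "c + 1 + h = k" using k unfolding c_def[symmetric] h_def by simp_all
  have rc: "r * card X ^ (r - 2) \<le> c" unfolding c_def n by (simp add: power2_eq_square)
  have finA: "finite (A i) \<and> card (A i) \<le> r" if "i \<in> {1..<k}" for i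
    using A[OF that] finX finite_subset by blast
  have finB: "finite (B i) \<and> card (B i) \<le> r" if "i \<in> {1..<k}" for i
    using B[OF that] finX finite_subset by blast
  let ?F = "A ` {1..c + 1}" and ?G = "B ` {1..h}" and ?H = "B ` {1..c + 1}"
  have subs: "{1..c + 1} \<subseteq> {1..<k}" "{1..h} \<subseteq> {1..<k}" "{1..c + 1} \<subseteq> {1..h}" using ch by auto
  have F: "?F \<subseteq> {C. C \<subseteq> X \<and> card C = r}" using A subs(1) by blast
  have G: "?G \<subseteq> {C. C \<subseteq> X \<and> card C = r}" using B subs(2) by blast
  have G0: "?H \<subseteq> {C. C \<subseteq> X \<and> card C = r}" using B subs(1) by blast
  have cards: "card ?F = c + 1" "card ?G = h" "card ?H = c + 1"
    using inj_on_subset[OF injA subs(1)] inj_on_subset[OF injB subs(2)] inj_on_subset[OF injB subs(1)]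
    by (simp_all add: card_image)
  have "\<exists>x. \<forall>C\<in>?F. x \<in> C"
  proof (rule common_element_of_large_cross[OF finX G r])
    show "?F \<noteq> {}" by simp
    show "finite C \<and> card C \<le> r" if "C \<in> ?F" for C using that finA subs(1) by blast
    show "cross ?F ?G" unfolding cross_def using meet ch by fastforce
    show "r\<^sup>2 * card X ^ (r - 2) < card ?G" using cards(2) ch(1) unfolding c_def n by simp
  qed
  then obtain x where x: "\<And>i. i \<in> {1..c + 1} \<Longrightarrow> x \<in> A i" by blast
  have xB: "x \<in> B j" if j: "j \<in> {1..h}" for j
  proof (rule ccontr)
    assume xj: "x \<notin> B j"
    have "card ?F \<le> r * card X ^ (r - 2)"
    proof (rule card_star_meeting_le[OF finX F r])
      show "x \<in> C" if "C \<in> ?F" for C using that x by blast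
      show "finite (B j)" "card (B j) \<le> r" using finB[of j] j subs(2) by auto
      show "x \<notin> B j" by (rule xj)
      show "C \<inter> B j \<noteq> {}" if "C \<in> ?F" for C using that meet[of _ j] j ch by fastforce
    qed
    then show False using cards(1) rc by simp
  qed
  have xA: "x \<in> A i" if i: "i \<in> {1..h}" for i
  proof (rule ccontr)
    assume xi: "x \<notin> A i"
    have "card ?H \<le> r * card X ^ (r - 2)"
    proof (rule card_star_meeting_le[OF finX G0 r])
      show "x \<in> C" if "C \<in> ?H" for C using that xB subs(3) by blast
      show "finite (A i)" "card (A i) \<le> r" using finA[of i] i subs(2) by auto
      show "x \<notin> A i" by (rule xi)
      show "C \<inter> A i \<noteq> {}" if C: "C \<in> ?H" for C
      proof -
        obtain j where "j \<in> {1..c + 1}" "C = B j" using C by blast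
        then show ?thesis using meet[of i j] i ch by (auto simp: Int_commute)
      qed
    qed
    then show False using cards(3) rc by simp
  qed
  show ?thesis
  proof
    have "1 \<in> {1..c + 1}" "1 \<in> {1..<k}" using ch by auto
    then show "x \<in> X" using x[of 1] A[of 1] by blast
    show "x \<in> A i \<and> x \<in> B i" if "1 \<le> i" "i + r\<^sup>2 * n ^ (r - 2) < k" for i
      using that xA[of i] xB[of i] ch unfolding c_def[symmetric] by simp
  qed
qed

text \<open>Split each sequence into sets through \<open>x\<close> and sets avoiding it. The former
  are distinct members of one star. The numbers \<open>a\<close>, \<open>b\<close> of the latter are
  bounded through distinct star members meeting \<open>{y, z, u, v}\<close>, that is, by the star
  minus its at least \<open>(n - 5) choose (r - 1)\<close> members avoiding these points, plus the
  exceptions.\<close>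

lemma length_bound:
  assumes r: "4 \<le> r" and n: "n = card X" "r + 5 \<le> n" and k: "2 * (r\<^sup>2 * n ^ (r - 2)) + 1 < k"
    and big: "3 * ((n - 2) choose (r - 2)) + 4 * r\<^sup>2 * n ^ (r - 3) + ((n - 5) choose (r - 1)) \<le> (n - 1) choose (r - 1)"
  shows "2 * (k - 1) + ((n - 5) choose (r - 1)) \<le> 2 * ((n - 1) choose (r - 1)) +
    2 * (2 * ((n - 4) choose (r - 3)) + 2 * r\<^sup>2 * n ^ (r - 4) + 1)"
proof -
  define c where "c = r\<^sup>2 * n ^ (r - 2)"
  define h where "h = k - c - 1"
  have ch: "c < h" "c + 1 + h = k" using k unfolding c_def[symmetric] h_def by simp_all
  obtain x where x: "x \<in> X" and "\<And>i. 1 \<le> i \<Longrightarrow> i + c < k \<Longrightarrow> x \<in> A i \<and> x \<in> B i"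
    unfolding c_def by (rule common_element_early[OF _ n(1) k]) (use r in auto)
  then have xAB: "x \<in> A i \<and> x \<in> B i" if "i \<in> {1..h}" for i using that ch by auto
  have early: "{i \<in> {1..<k}. x \<notin> A i} \<subseteq> {h<..<k}" "{i \<in> {1..<k}. x \<notin> B i} \<subseteq> {h<..<k}"
    using xAB by force+
  define a where "a = card {i \<in> {1..<k}. x \<notin> A i}"
  define b where "b = card {i \<in> {1..<k}. x \<notin> B i}"
  define e where "e = 2 * ((n - 4) choose (r - 3)) + 2 * r\<^sup>2 * n ^ (r - 4) + 1"
  have "a \<le> card {h<..<k}" "b \<le> card {h<..<k}" unfolding a_def b_def 
    by (rule card_mono[OF _ early(1)], simp) (rule card_mono[OF _ early(2)], simp)
  \<comment> \<open>Needed so that the first \<open>a\<close> (or \<open>b\<close>) sets of the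
    opposite sequence all contain \<open>x\<close>.\<close>
  then have abh: "a \<le> h" "b \<le> h" using ch by simp_all
  interpret swap: cross_sequences X r k B A by (rule swapped)
  have hk: "h < k" using ch by simp
  note fa = early_structure[OF r x n(1) _ hk a_def abh(1)] swap.early_structure[OF r x n(1) _ hk b_def abh(2)]
  have ca: "a \<le> 2 * ((n - 2) choose (r - 2)) + 2 * r\<^sup>2 * n ^ (r - 3)" using fa(1) xAB by blast
  have cb: "b \<le> 2 * ((n - 2) choose (r - 2)) + 2 * r\<^sup>2 * n ^ (r - 3)" using fa(3) xAB by blast
  have fina: "a \<le> ((n - 2) choose (r - 2)) + 2 * r\<^sup>2 * n ^ (r - 3) \<or>
      (\<exists>y\<in>X - {x}. \<exists>z\<in>X - {x}. a \<le> card {j \<in> {1..a}. y \<in> B j \<or> z \<in> B j} + e)"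
    unfolding e_def using fa(2) xAB by blast
  have finb: "b \<le> ((n - 2) choose (r - 2)) + 2 * r\<^sup>2 * n ^ (r - 3) \<or>
      (\<exists>y\<in>X - {x}. \<exists>z\<in>X - {x}. b \<le> card {j \<in> {1..b}. y \<in> A j \<or> z \<in> A j} + e)"
    unfolding e_def using fa(4) xAB by blast
  have ab: "a + b + ((n - 5) choose (r - 1)) \<le> ((n - 1) choose (r - 1)) + 2 * e"
  proof (cases "a \<le> ((n - 2) choose (r - 2)) + 2 * r\<^sup>2 * n ^ (r - 3) \<or>
      b \<le> ((n - 2) choose (r - 2)) + 2 * r\<^sup>2 * n ^ (r - 3)")
    case True
    \<comment> \<open>If one side has no structure, it contributes only one leading binomial
      coefficient instead of two; the total of three stays below the four that \<open>big\<close>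
      provides.\<close>
    then have "a + b \<le> 3 * ((n - 2) choose (r - 2)) + 4 * r\<^sup>2 * n ^ (r - 3)" using ca cb by auto
    then show ?thesis using big by linarith
  next
    case False
    then obtain y z u v where yz: "y \<in> X - {x}" "z \<in> X - {x}" "a \<le> card {j \<in> {1..a}. y \<in> B j \<or> z \<in> B j} + e"
      and uv: "u \<in> X - {x}" "v \<in> X - {x}" "b \<le> card {j \<in> {1..b}. u \<in> A j \<or> v \<in> A j} + e"
      using fina finb by blast
    let ?Y = "{y, z, u, v}" and ?S = "{C. C \<subseteq> X \<and> card C = r \<and> {x} \<subseteq> C \<and> C \<inter> {} = {}}"
    let ?T = "{C. C \<subseteq> X \<and> card C = r \<and> {x} \<subseteq> C \<and> C \<inter> ?Y = {}}"
    let ?JB = "{j \<in> {1..a}. y \<in> B j \<or> z \<in> B j}" and ?JA = "{j \<in> {1..b}. u \<in> A j \<or> v \<in> A j}"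
    have J: "?JB \<subseteq> {1..h}" "?JA \<subseteq> {1..h}" "{1..h} \<subseteq> {1..<k}" using abh ch by auto
    have finS: "finite ?S" by (rule finite_subset[of _ "Pow X"]) (use finX in auto)
    have subB: "B ` ?JB \<subseteq> ?S - ?T"
    proof
      fix C assume "C \<in> B ` ?JB"
      then obtain j where "j \<in> {1..h}" "C = B j" "y \<in> C \<or> z \<in> C" using J(1) by blast
      moreover from this have "C \<subseteq> X \<and> card C = r \<and> x \<in> C" using B[of j] xAB[of j] J(3) by blast
      ultimately show "C \<in> ?S - ?T" by blast
    qed
    have subA: "A ` ?JA \<subseteq> ?S - ?T"
    proof
      fix C assume "C \<in> A ` ?JA"
      then obtain j where "j \<in> {1..h}" "C = A j" "u \<in> C \<or> v \<in> C" using J(2) by blast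
      moreover from this have "C \<subseteq> X \<and> card C = r \<and> x \<in> C" using A[of j] xAB[of j] J(3) by blast
      ultimately show "C \<in> ?S - ?T" by blast
    qed
    have "card ?JB = card (B ` ?JB)" "card ?JA = card (A ` ?JA)"
      using inj_on_subset[OF injB order_trans[OF J(1,3)]] inj_on_subset[OF injA order_trans[OF J(2,3)]]
      by (simp_all add: card_image)
    moreover have "card (B ` ?JB \<union> A ` ?JA) = card (B ` ?JB) + card (A ` ?JA)"
    proof (rule card_Un_disjoint)
      show "B ` ?JB \<inter> A ` ?JA = {}" using AB J by blast
    qed simp_all
    moreover have "card (B ` ?JB \<union> A ` ?JA) \<le> card (?S - ?T)"
      by (rule card_mono) (use finS subA subB in auto)
    moreover have "card (?S - ?T) = card ?S - card ?T"
      by (rule card_Diff_subset) (use finS finite_subset[of ?T ?S] in auto)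
    moreover have "card ?S = (n - 1) choose (r - 1)"
      using card_subsets_between[of X "{x}" "{}" r] finX x n(1) r by simp
    \<comment> \<open>The four points may coincide, which only enlarges the family avoiding
      them.\<close>
    moreover have "(n - 5) choose (r - 1) \<le> card ?T"
    proof -
      have "card ?Y \<le> 4" using card_length[of "[y, z, u, v]"] by simp
      moreover have "card ?T = (n - 1 - card ?Y) choose (r - 1)"
        using card_subsets_between[of X "{x}" ?Y r] finX x n(1) r yz(1,2) uv(1,2) by simp
      ultimately show ?thesis by (simp add: binomial_right_mono)
    qed
    moreover have "card ?T \<le> card ?S" by (rule card_mono) (use finS in auto)
    ultimately show ?thesis using yz(3) uv(3) by linarith
  qed
  let ?IA = "{i \<in> {1..<k}. x \<in> A i}" and ?IB = "{i \<in> {1..<k}. x \<in> B i}"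
  have "k - 1 = a + card ?IA" "k - 1 = b + card ?IB"
    unfolding a_def b_def
    using card_Int_Diff[of "{1..<k}" "{i. x \<notin> A i}"] card_Int_Diff[of "{1..<k}" "{i. x \<notin> B i}"]
    by (simp_all add: Int_def set_diff_eq)
  moreover have "card ?IA + card ?IB \<le> (n - 1) choose (r - 1)"
  proof -
    have I: "?IA \<subseteq> {1..<k}" "?IB \<subseteq> {1..<k}" by auto
    have "card ?IA = card (A ` ?IA)" "card ?IB = card (B ` ?IB)"
      using inj_on_subset[OF injA I(1)] inj_on_subset[OF injB I(2)] by (simp_all add: card_image)
    moreover have "card (A ` ?IA \<union> B ` ?IB) = card (A ` ?IA) + card (B ` ?IB)"
    proof (rule card_Un_disjoint)
      show "A ` ?IA \<inter> B ` ?IB = {}" using AB by blast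
    qed simp_all
    moreover have "card (A ` ?IA \<union> B ` ?IB) \<le> (card X - card {x}) choose (r - card {x})"
      by (rule card_supersets_le[OF finX]) (use A B r in auto)
    ultimately show ?thesis using n(1) by simp
  qed
  ultimately show ?thesis using ab unfolding e_def by linarith
qed

end

section \<open>Arrangements built from blocks\<close>

lemma ex_bij_betw_monotone_ranking:
  fixes key :: "'a \<Rightarrow> nat"
  assumes "finite V"
  shows "\<exists>f. bij_betw f V {1..card V} \<and> (\<forall>u\<in>V. \<forall>v\<in>V. key u < key v \<longrightarrow> f u < f v)"
  using assms
\<comment> \<open>The induction inserts elements in nondecreasing order of \<open>key\<close>, so
  each new one may take the highest rank; ties are broken arbitrarily.\<close>
proof (induction V rule: finite_ranking_induct[where f = key])
  case empty
  show ?case by (simp add: bij_betw_def)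
next
  case (insert x V)
  show ?case
  proof (cases "x \<in> V")
    case True
    then show ?thesis using insert.IH by (simp add: insert_absorb)
  next
    case x: False
    obtain f where f: "bij_betw f V {1..card V}"
      and mono: "\<And>u v. u \<in> V \<Longrightarrow> v \<in> V \<Longrightarrow> key u < key v \<Longrightarrow> f u < f v" using insert.IH by blast
    define g where "g v = (if v = x then Suc (card V) else f v)" for v
    have g: "g x = Suc (card V)" "\<And>v. v \<in> V \<Longrightarrow> g v = f v" using x by (auto simp: g_def)
    have fV: "f v \<le> card V" if "v \<in> V" for v using f that by (auto simp: bij_betw_def)
    have "bij_betw g V {1..card V}" using f by (subst bij_betw_cong[OF g(2)])
    moreover have "bij_betw g {x} {Suc (card V)}" using g(1) by (simp add: bij_betw_def)
    ultimately have "bij_betw g (V \<union> {x}) ({1..card V} \<union> {Suc (card V)})"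
      by (rule bij_betw_combine) simp
    moreover have "{1..card V} \<union> {Suc (card V)} = {1..card (insert x V)}"
      using insert.hyps(1) x by auto
    moreover have "g u < g v" if uv: "u \<in> insert x V" "v \<in> insert x V" "key u < key v" for u v
    proof -
      have "u \<in> V" using uv insert.hyps(2)[of v] by auto
      then show ?thesis using uv mono[of u v] fV[of u] g by (auto simp: less_Suc_eq_le)
    qed
    ultimately show ?thesis by (intro exI[of _ g]) simp
  qed
qed

lemma card_less_ranking:
  fixes f key :: "'a \<Rightarrow> nat"
  assumes V: "finite V" and f: "bij_betw f V {1..card V}"
    and mono: "\<And>u v. u \<in> V \<Longrightarrow> v \<in> V \<Longrightarrow> key u < key v \<Longrightarrow> f u < f v"
    and v: "v \<in> V"
  shows "card {u \<in> V. key u < key v} + 1 \<le> f v" "f v + card {u \<in> V. key v < key u} \<le> card V"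
proof -
  have inj: "inj_on f V" and img: "f ` V = {1..card V}" using f by (simp_all add: bij_betw_def)
  have card: "card {u \<in> V. P u} = card (f ` {u \<in> V. P u})" for P
    by (rule card_image[symmetric], rule inj_on_subset[OF inj]) blast
  have "f ` {u \<in> V. key u < key v} \<subseteq> {1..<f v}" using mono v img by fastforce
  then have "card {u \<in> V. key u < key v} \<le> card {1..<f v}" unfolding card by (rule card_mono[rotated]) simp
  moreover have fv: "f v \<in> {1..card V}" using img v by blast
  ultimately show "card {u \<in> V. key u < key v} + 1 \<le> f v" by (auto simp del: One_nat_def)
  have "f ` {u \<in> V. key v < key u} \<subseteq> {f v<..card V}" using mono v img by fastforce
  then have "card {u \<in> V. key v < key u} \<le> card {f v<..card V}" unfolding card by (rule card_mono[rotated]) simp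
  then show "f v + card {u \<in> V. key v < key u} \<le> card V" using fv by auto
qed

text \<open>Ranking by \<open>key\<close> puts all vertices of smaller key before \<open>u\<close>
  and all of larger key after \<open>v\<close>; an edge from \<open>u\<close> to \<open>v\<close>
  cannot stretch over these, nor over one of its own end points. Only strict comparisons are
  counted, so the order within a class is irrelevant.\<close>

lemma bandwidth_le_of_key:
  fixes key :: "'a \<Rightarrow> nat"
  assumes V: "finite (pverts G)" and E: "\<And>u v. (u, v) \<in> parcs G \<Longrightarrow> u \<in> pverts G \<and> v \<in> pverts G \<and> (v, u) \<in> parcs G"
    and key: "\<And>u v. (u, v) \<in> parcs G \<Longrightarrow> key u \<le> key v \<Longrightarrow>
      \<kappa> \<le> card {w \<in> pverts G. key w < key u} + card {w \<in> pverts G. key v < key w}"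
  shows "bandwidth G \<le> card (pverts G) - \<kappa> - 1"
proof -
  let ?V = "pverts G"
  obtain f where f: "bij_betw f ?V {1..card ?V}"
    and mono: "\<And>u v. u \<in> ?V \<Longrightarrow> v \<in> ?V \<Longrightarrow> key u < key v \<Longrightarrow> f u < f v"
    using ex_bij_betw_monotone_ranking[OF V] by metis
  note rank = card_less_ranking[of ?V f key, OF V f mono]
  have one: "f v - f u \<le> card ?V - \<kappa> - 1" if "(u, v) \<in> parcs G" for u v
  proof (cases "key u \<le> key v")
    case True
    then show ?thesis
      using key[OF that] rank(1)[where v = u] rank(2)[where v = v] E[OF that] by simp
  next
    case False
    then show ?thesis using mono[of v u] E[OF that] by simp
  qed
  have "nat \<bar>int (f u) - int (f v)\<bar> \<le> card ?V - \<kappa> - 1" if "(u, v) \<in> parcs G" for u v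
    using one[OF that] one[of v u] E[OF that] by linarith
  moreover have "finite {nat \<bar>int (f v) - int (f w)\<bar> | v w. (v, w) \<in> parcs G}"
  proof (rule finite_subset)
    show "{nat \<bar>int (f v) - int (f w)\<bar> | v w. (v, w) \<in> parcs G}
        \<subseteq> (\<lambda>(v, w). nat \<bar>int (f v) - int (f w)\<bar>) ` (?V \<times> ?V)" using E by fast
  qed (use V in simp)
  ultimately have "dilation G f \<le> card ?V - \<kappa> - 1"
    unfolding dilation_def by (subst Max_le_iff) auto
  then show ?thesis using bandwidth_le[OF f] by simp
qed

lemma card_labels:
  assumes "finite V" "finite J"
  shows "card {v \<in> V. p v \<in> J} = (\<Sum>i\<in>J. card {v \<in> V. p v = i})"
  using assms(2)
proof induction
  case (insert i J)
  have "{v \<in> V. p v \<in> insert i J} = {v \<in> V. p v = i} \<union> {v \<in> V. p v \<in> J}" by auto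
  moreover have "card ({v \<in> V. p v = i} \<union> {v \<in> V. p v \<in> J}) =
      card {v \<in> V. p v = i} + card {v \<in> V. p v \<in> J}"
    by (rule card_Un_disjoint) (use assms(1) insert.hyps in auto)
  ultimately show ?case using insert by simp
qed simp

text \<open>
  The labels \<open>p\<close>, \<open>q\<close> (and likewise \<open>p'\<close>, \<open>q'\<close>) name the blocks \<open>P\<^sub>0, P\<^sub>1, \<dots>\<close> and
  \<open>Q\<^sub>0, Q\<^sub>1, \<dots>\<close>, a label \<open>\<ge> m\<close> meaning that the vertex is in no block. With \<open>l = m - 1\<close>, the vertices
  are arranged as \<open>P'\<^sub>0 \<dots> P'\<^sub>l M Q\<^sub>l \<dots> Q\<^sub>0 R Q'\<^sub>0 \<dots> Q'\<^sub>l M' P\<^sub>l \<dots> P\<^sub>0\<close>, where \<open>M\<close> and \<open>M'\<close>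
  share what the blocks leave of \<open>U\<close> in such a way that both ends become equally long.
\<close>

lemma bandwidth_le_of_blocks:
  fixes G :: "'a pair_pre_digraph" and p q p' q' :: "'a \<Rightarrow> nat" and m \<kappa> :: nat
  defines "V \<equiv> pverts G"
  assumes V: "finite V" and E: "\<And>u v. (u, v) \<in> parcs G \<Longrightarrow> u \<in> V \<and> v \<in> V \<and> (v, u) \<in> parcs G"
    and U: "U \<subseteq> V" "\<And>u v. u \<in> U \<Longrightarrow> v \<in> U \<Longrightarrow> (u, v) \<notin> parcs G"
    and p: "\<And>v. v \<in> V \<Longrightarrow> p v < m \<Longrightarrow> v \<in> U \<and> m \<le> p' v" and p': "\<And>v. v \<in> V \<Longrightarrow> p' v < m \<Longrightarrow> v \<in> U"
    and q: "\<And>v. v \<in> V \<Longrightarrow> q v < m \<Longrightarrow> v \<notin> U \<and> m \<le> q' v" and q': "\<And>v. v \<in> V \<Longrightarrow> q' v < m \<Longrightarrow> v \<notin> U"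
    and pq: "\<And>u v. (u, v) \<in> parcs G \<Longrightarrow> q u < m \<Longrightarrow> q u < p v"
    and pq': "\<And>u v. (u, v) \<in> parcs G \<Longrightarrow> q' u < m \<Longrightarrow> q' u < p' v"
    and card: "\<And>i. i < m \<Longrightarrow> card {v \<in> V. p v = i} \<le> card {v \<in> V. q v = i}"
    and card': "\<And>i. i < m \<Longrightarrow> card {v \<in> V. p' v = i} \<le> card {v \<in> V. q' v = i}"
    and s: "s = card {v \<in> V. p v < m}" "s' = card {v \<in> V. p' v < m}"
    and k: "s + s' \<le> \<kappa>" "\<kappa> \<le> card U" "2 * \<kappa> \<le> card U + s + s'"
  shows "bandwidth G \<le> card V - \<kappa> - 1"
proof -
  have finU: "finite U" using U(1) V by (rule finite_subset)
  define W where "W = {v \<in> U. m \<le> p v \<and> m \<le> p' v}"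
  have finW: "finite W" using finU by (simp add: W_def)
  have U_split: "card U = s + s' + card W"
  proof -
    have "U = ({v \<in> V. p v < m} \<union> {v \<in> V. p' v < m}) \<union> W"
      using U(1) p p' unfolding W_def by force
    moreover have "card (({v \<in> V. p v < m} \<union> {v \<in> V. p' v < m}) \<union> W) =
        card ({v \<in> V. p v < m} \<union> {v \<in> V. p' v < m}) + card W"
      by (rule card_Un_disjoint) (use V finW in \<open>auto simp: W_def\<close>)
    moreover have "card ({v \<in> V. p v < m} \<union> {v \<in> V. p' v < m}) = s + s'"
      unfolding s by (rule card_Un_disjoint) (use V p in force)+
    ultimately show ?thesis by simp
  qed
  \<comment> \<open>This size gives the front piece \<open>P'\<close> with \<open>M\<close> exactly
    \<open>\<kappa> - s\<close> vertices. It is available since \<open>\<kappa> \<le> card U\<close>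
    and \<open>W\<close> has \<open>card U - s - s'\<close> elements.\<close>
  obtain M where M: "M \<subseteq> W" "card M = \<kappa> - s - s'"
    using obtain_subset_with_card_n[of "\<kappa> - s - s'" W] U_split k by (metis diff_le_mono add_diff_cancel_left' diff_diff_left)
  have MU: "M \<subseteq> U" using M(1) unfolding W_def by blast
  have finM: "finite M" using M(1) finW by (rule finite_subset)
  \<comment> \<open>Keys along the arrangement: \<open>P'\<close> gets \<open>0..m - 1\<close>,
    \<open>M\<close> gets \<open>m\<close>, \<open>Q\<close> gets \<open>m + 1..2 * m\<close> in
    reverse, the remaining vertices \<open>2 * m + 1\<close>, \<open>Q'\<close> gets
    \<open>2 * m + 2..3 * m + 1\<close>, \<open>M'\<close> gets \<open>3 * m + 3\<close>, and
    \<open>P\<close> gets \<open>3 * m + 4..4 * m + 3\<close> in reverse.\<close>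
  define key where "key v = (if p' v < m then p' v else if v \<in> M then m
      else if q v < m then 2 * m - q v else if q' v < m then 2 * m + 2 + q' v
      else if v \<notin> U then 2 * m + 1 else if p v < m then 4 * m + 3 - p v else 3 * m + 3)" for v
  have key_p': "key v = p' v" if "v \<in> V" "p' v < m" for v using that by (simp add: key_def)
  have key_M: "key v = m" if "v \<in> M" for v using that M(1) by (auto simp: key_def W_def)
  have key_q: "key v = 2 * m - q v" if "v \<in> V" "q v < m" for v
    using that q[of v] p'[of v] MU by (auto simp: key_def)
  have key_q': "key v = 2 * m + 2 + q' v" if "v \<in> V" "q' v < m" for v
    using that q[of v] q'[of v] p'[of v] MU by (auto simp: key_def)
  have key_p: "key v = 4 * m + 3 - p v" if "v \<in> V" "p v < m" for v
    using that q[of v] q'[of v] p[of v] M(1) by (auto simp: key_def W_def)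
  have key_M': "key v = 3 * m + 3" if "v \<in> W - M" for v
    using that q[of v] q'[of v] U(1) by (auto simp: key_def W_def)
  define before where "before v = card {w \<in> V. key w < key v}" for v
  define after where "after v = card {w \<in> V. key v < key w}" for v
  have before_ge: "card S \<le> before v" if "S \<subseteq> V" "\<And>w. w \<in> S \<Longrightarrow> key w < key v" for S v
    unfolding before_def by (rule card_mono) (use V that in auto)
  have after_ge: "card S \<le> after v" if "S \<subseteq> V" "\<And>w. w \<in> S \<Longrightarrow> key v < key w" for S v
    unfolding after_def by (rule card_mono) (use V that in auto)
  \<comment> \<open>Here \<open>R\<close> and \<open>R'\<close> are the two end pieces of
    \<open>U\<close>, namely \<open>P'\<close> with \<open>M\<close> and \<open>M'\<close> with
    \<open>P\<close>. Their sizes satisfy \<open>card R + s = \<kappa>\<close> and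
    \<open>card R' + s' \<ge> \<kappa>\<close>.\<close>
  define R where "R = {v \<in> V. p' v < m} \<union> M"
  define R' where "R' = {v \<in> V. p v < m} \<union> (W - M)"
  have finR: "finite R" "finite R'" using V finM finW by (auto simp: R_def R'_def)
  have RV: "R \<subseteq> V" "R' \<subseteq> V" using M(1) U(1) by (auto simp: R_def R'_def W_def)
  have RU: "R \<subseteq> U" "R' \<subseteq> U" using MU p p' by (auto simp: R_def R'_def W_def)
  have cardR: "card R = \<kappa> - s"
  proof -
    have "card R = card {v \<in> V. p' v < m} + card M"
      unfolding R_def by (rule card_Un_disjoint) (use V finM M(1) in \<open>auto simp: W_def\<close>)
    then show ?thesis using M(2) s k by simp
  qed
  have cardR': "card R' + (\<kappa> - s) = card U"
  proof -
    have "card R' = card {v \<in> V. p v < m} + card (W - M)"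
      unfolding R'_def by (rule card_Un_disjoint) (use V finW in \<open>auto simp: W_def\<close>)
    moreover have "card (W - M) = card W - card M" by (rule card_Diff_subset[OF finM M(1)])
    moreover have "card M \<le> card W" by (rule card_mono[OF finW M(1)])
    ultimately show ?thesis using M(2) s k(1) U_split by simp
  qed
  have key_R: "key w \<le> m" if "w \<in> R" for w
    using that key_p'[of w] key_M[of w] by (auto simp: R_def)
  have key_R': "3 * m + 3 \<le> key w" if "w \<in> R'" for w
    using that key_p[of w] key_M'[of w] by (auto simp: R'_def)
  have le: "card {v \<in> V. p v \<in> J} \<le> card {v \<in> V. q v \<in> J}"
    "card {v \<in> V. p' v \<in> J} \<le> card {v \<in> V. q' v \<in> J}" if "J \<subseteq> {..<m}" for J
  proof -
    have "finite J" using that by (rule finite_subset) simp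
    then show "card {v \<in> V. p v \<in> J} \<le> card {v \<in> V. q v \<in> J}"
      "card {v \<in> V. p' v \<in> J} \<le> card {v \<in> V. q' v \<in> J}"
      using that card card' V by (auto simp: card_labels intro!: sum_mono)
  qed
  have split: "card {v \<in> V. g v < m} = card {v \<in> V. g v \<le> i} + card {v \<in> V. g v \<in> {i<..<m}}"
    if "i < m" for g :: "'a \<Rightarrow> nat" and i
  proof -
    have "{v \<in> V. g v < m} = {v \<in> V. g v \<le> i} \<union> {v \<in> V. g v \<in> {i<..<m}}" using that by auto
    moreover have "card ({v \<in> V. g v \<le> i} \<union> {v \<in> V. g v \<in> {i<..<m}}) =
        card {v \<in> V. g v \<le> i} + card {v \<in> V. g v \<in> {i<..<m}}"
      by (rule card_Un_disjoint) (use V in auto)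
    ultimately show ?thesis by simp
  qed
  have cardRQ: "card (R \<union> {v \<in> V. q v \<in> J}) = (\<kappa> - s) + card {v \<in> V. q v \<in> J}" if "J \<subseteq> {..<m}" for J
    unfolding cardR[symmetric] by (rule card_Un_disjoint) (use finR V RU q that in auto)
  have cardRQ': "card (R' \<union> {v \<in> V. q' v \<in> J}) = card R' + card {v \<in> V. q' v \<in> J}" if "J \<subseteq> {..<m}" for J
    by (rule card_Un_disjoint) (use finR V RU q' that in auto)
  have J: "{i<..<m} \<subseteq> {..<m}" "{..<m} \<subseteq> {..<m}" for i by auto
  show ?thesis unfolding V_def
  proof (rule bandwidth_le_of_key)
    show "finite (pverts G)" using V unfolding V_def .
    show "u \<in> pverts G \<and> v \<in> pverts G \<and> (v, u) \<in> parcs G" if "(u, v) \<in> parcs G" for u v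
      using E[OF that] unfolding V_def .
    fix u v assume uv: "(u, v) \<in> parcs G" and keys: "key u \<le> key v"
    have inV: "u \<in> V" "v \<in> V" and vu: "(v, u) \<in> parcs G" using E[OF uv] by auto
    have "\<kappa> \<le> before u + after v"
    proof (cases "2 * m < key u")
      case True
      \<comment> \<open>Beyond \<open>Q\<close>, the vertex \<open>u\<close> has \<open>R\<close>
        and all of \<open>Q\<close> before it, and \<open>Q\<close> is at least as large as
        \<open>P\<close>, of size \<open>s\<close>. If instead \<open>v\<close> comes before
        \<open>Q'\<close>, the mirror argument uses \<open>R'\<close> and \<open>Q'\<close>.\<close>
      have "card (R \<union> {w \<in> V. q w \<in> {..<m}}) \<le> before u"
        by (rule before_ge) (use RV key_R key_q True in fastforce)+
      then show ?thesis using cardRQ[OF J(2)] le(1)[OF J(2)] s by simp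
    next
      case u: False
      show ?thesis
      proof (cases "key v \<le> 2 * m + 1")
        case True
        have "card (R' \<union> {w \<in> V. q' w \<in> {..<m}}) \<le> after v"
          by (rule after_ge) (use RV key_R' key_q' True in fastforce)+
        then show ?thesis using cardRQ'[OF J(2)] le(2)[OF J(2)] s k cardR' by simp
      next
        case v: False
        have "u \<in> R \<or> q u < m" using u inV unfolding key_def R_def by (auto split: if_splits)
        moreover have "v \<in> R' \<or> q' v < m"
          using v inV MU unfolding key_def R'_def W_def by (auto split: if_splits)
        ultimately consider "u \<in> R" "v \<in> R'" | "q u < m" "v \<in> R'" | "u \<in> R" "q' v < m" | "q u < m" "q' v < m"
          by blast
        then show ?thesis
        proof cases
          case 1
          then show ?thesis using RU U(2)[of u v] uv by blast
        next
          case 2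
          \<comment> \<open>If \<open>u\<close> is in the block \<open>i\<close> of
            \<open>Q\<close>, adjacency puts \<open>v\<close> in \<open>M'\<close> or in a block of
            \<open>P\<close> with label above \<open>i\<close>. So \<open>P\<^sub>0\<close>, ...,
            \<open>P\<^sub>i\<close> come after \<open>v\<close>, and the later-labelled blocks of
            \<open>Q\<close>, which come before \<open>u\<close>, make up for the rest of
            \<open>P\<close>.\<close>
          have "q u < p v" using pq[OF uv 2(1)] .
          have "card (R \<union> {w \<in> V. q w \<in> {q u<..<m}}) \<le> before u"
          proof (rule before_ge)
            show "R \<union> {w \<in> V. q w \<in> {q u<..<m}} \<subseteq> V" using RV by blast
            show "key w < key u" if "w \<in> R \<union> {w \<in> V. q w \<in> {q u<..<m}}" for w
              using that key_R[of w] key_q[of w] key_q[OF inV(1) 2(1)] 2(1) by auto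
          qed
          moreover have "card {w \<in> V. p w \<le> q u} \<le> after v"
          proof (rule after_ge)
            show "key v < key w" if "w \<in> {w \<in> V. p w \<le> q u}" for w
              using that key_p[of w] key_p[of v] key_M'[of v] 2 \<open>q u < p v\<close> unfolding R'_def by auto
          qed blast
          ultimately show ?thesis
            using cardRQ[OF J(1)[of "q u"]] le(1)[OF J(1)[of "q u"]] split[OF 2(1), of p] s k(1) by linarith
        next
          case 3
          have "q' v < p' u" using pq'[OF vu 3(2)] .
          have "card (R' \<union> {w \<in> V. q' w \<in> {q' v<..<m}}) \<le> after v"
          proof (rule after_ge)
            show "R' \<union> {w \<in> V. q' w \<in> {q' v<..<m}} \<subseteq> V" using RV by blast
            show "key v < key w" if "w \<in> R' \<union> {w \<in> V. q' w \<in> {q' v<..<m}}" for w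
              using that key_R'[of w] key_q'[of w] key_q'[OF inV(2) 3(2)] 3(2) by auto
          qed
          moreover have "card {w \<in> V. p' w \<le> q' v} \<le> before u"
          proof (rule before_ge)
            show "key w < key u" if "w \<in> {w \<in> V. p' w \<le> q' v}" for w
              using that key_p'[of w] key_p'[of u] key_M[of u] 3 \<open>q' v < p' u\<close> unfolding R_def by auto
          qed blast
          ultimately show ?thesis
            using cardRQ'[OF J(1)[of "q' v"]] le(2)[OF J(1)[of "q' v"]] split[OF 3(2), of p'] s k cardR'
            by linarith
        next
          case 4
          \<comment> \<open>Both end pieces lie outside the edge, and together they are all of
            \<open>U\<close>.\<close>
          have "card R \<le> before u"
            by (rule before_ge[OF RV(1)]) (use key_R key_q[OF inV(1) 4(1)] 4(1) in fastforce)
          moreover have "card R' \<le> after v"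
            by (rule after_ge[OF RV(2)]) (use key_R' key_q'[OF inV(2) 4(2)] 4(2) in fastforce)
          ultimately show ?thesis using cardR cardR' k(2) by simp
        qed
      qed
    qed
    then show "\<kappa> \<le> card {w \<in> pverts G. key w < key u} + card {w \<in> pverts G. key v < key w}"
      unfolding before_def after_def V_def .
  qed
qed

section \<open>The extremal arrangement\<close>

lemma pverts_kneser: "pverts (kneser n r) = {A. A \<subseteq> {1..n} \<and> card A = r}"
  and parcs_kneser: "parcs (kneser n r) =
    {(A, B). A \<in> pverts (kneser n r) \<and> B \<in> pverts (kneser n r) \<and> A \<inter> B = {}}"
  by (simp_all add: kneser_def Let_def)

lemma finite_pverts_kneser: "finite (pverts (kneser n r))"
  unfolding pverts_kneser by (rule finite_subset[of _ "Pow {1..n}"]) auto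

lemma card_pverts_kneser: "card (pverts (kneser n r)) = n choose r"
  unfolding pverts_kneser using n_subsets[of "{1..n}" r] by simp

lemma card_kneser_between:
  assumes "P \<subseteq> {1..n}" "Q \<subseteq> {1..n}" "P \<inter> Q = {}" "card P = p" "card Q = q" "p \<le> r"
    and "n - p - q = m" "r - p = j"
  shows "card {A \<in> pverts (kneser n r). P \<subseteq> A \<and> A \<inter> Q = {}} = m choose j"
  using card_subsets_between[of "{1..n}" P Q r] assms by (simp add: pverts_kneser)

text \<open>
  The blocks \<open>P\<^sub>i\<close> inside and \<open>Q\<^sub>i\<close> outside the star of \<open>1\<close>; the label \<open>6\<close> stands for no block.
  They are chosen such that every member of \<open>P\<^sub>j\<close> meets every member of \<open>Q\<^sub>i\<close> for \<open>j \<le> i\<close>.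
  The forbidden sets \<open>W\<close> and \<open>Z\<close> keep the blocks at the two ends of the arrangement disjoint.
\<close>

definition inner_label :: "nat \<Rightarrow> nat \<Rightarrow> nat \<Rightarrow> nat \<Rightarrow> nat \<Rightarrow> nat set \<Rightarrow> nat set \<Rightarrow> nat set \<Rightarrow> nat" where
  "inner_label a b c d e W Z A =
    (if 1 \<notin> A \<or> A \<inter> W \<noteq> {} then 6
     else if a \<in> A then 0
     else if b \<in> A then (if c \<in> A then 1 else if d \<in> A then 2 else 3)
     else if A \<inter> Z \<noteq> {} \<or> c \<notin> A then 6
     else if d \<in> A then 4 else if e \<in> A then 5 else 6)"

definition outer_label :: "nat \<Rightarrow> nat \<Rightarrow> nat \<Rightarrow> nat \<Rightarrow> nat set \<Rightarrow> nat set \<Rightarrow> nat" where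
  "outer_label a b c d W A =
    (if 1 \<in> A \<or> A \<inter> W \<noteq> {} \<or> a \<notin> A then 6
     else if b \<in> A then (if c \<in> A then 5 else if d \<in> A then 4 else 3)
     else if c \<in> A then (if d \<in> A then 2 else 1)
     else 0)"

text \<open>Disjointness leaves each of \<open>a\<close>, \<open>b\<close>, \<open>c\<close>,
  \<open>d\<close> in at most one of the two sets, and the case distinctions on these points exclude
  every inner label up to the outer one.\<close>

lemma outer_label_less_inner_label:
  assumes "A \<inter> B = {}" "outer_label a b c d W' A < 6"
  shows "outer_label a b c d W' A < inner_label a b c d e W Z B"
proof -
  have "x \<notin> A \<or> x \<notin> B" for x using assms(1) by blast
  from this[of a] this[of b] this[of c] this[of d] show ?thesis
    using assms(2) unfolding inner_label_def outer_label_def by (auto split: if_splits)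
qed

lemma card_inner_label:
  assumes X: "{1, a, b, c, d, e} \<union> W \<union> Z \<subseteq> {1..n}"
    and dist: "distinct [1, a, b, c, d, e]" "{1, a, b, c, d, e} \<inter> (W \<union> Z) = {}" "W \<inter> Z = {}"
    and r: "3 \<le> r"
  defines "N i \<equiv> card {A \<in> pverts (kneser n r). inner_label a b c d e W Z A = i}"
  shows "N 0 = (n - 2 - card W) choose (r - 2)"
    and "N 1 = (n - 4 - card W) choose (r - 3)"
    and "N 2 = (n - 5 - card W) choose (r - 3)"
    and "N 3 = (n - 5 - card W) choose (r - 2)"
    and "N 4 = (n - 5 - card W - card Z) choose (r - 3)"
    and "N 5 = (n - 6 - card W - card Z) choose (r - 3)"
proof -
  let ?V = "pverts (kneser n r)"
  have "W \<subseteq> {1..n}" "Z \<subseteq> {1..n}" using X by blast+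
  then have fin: "finite W" "finite Z" using finite_subset[OF _ finite_atLeastAtMost[of 1 n]] by simp_all
  note simps = X[simplified] dist(1)[simplified] dist(2)[simplified] fin
  have cardWZ: "card (W \<union> Z) = card W + card Z" using fin dist(3) by (rule card_Un_disjoint)
  have eq: "{A \<in> ?V. inner_label a b c d e W Z A = 0} = {A \<in> ?V. {1, a} \<subseteq> A \<and> A \<inter> W = {}}"
    "{A \<in> ?V. inner_label a b c d e W Z A = 1} = {A \<in> ?V. {1, b, c} \<subseteq> A \<and> A \<inter> insert a W = {}}"
    "{A \<in> ?V. inner_label a b c d e W Z A = 2} = {A \<in> ?V. {1, b, d} \<subseteq> A \<and> A \<inter> insert a (insert c W) = {}}"
    "{A \<in> ?V. inner_label a b c d e W Z A = 3} =
      {A \<in> ?V. {1, b} \<subseteq> A \<and> A \<inter> insert a (insert c (insert d W)) = {}}"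
    "{A \<in> ?V. inner_label a b c d e W Z A = 4} =
      {A \<in> ?V. {1, c, d} \<subseteq> A \<and> A \<inter> insert a (insert b (W \<union> Z)) = {}}"
    "{A \<in> ?V. inner_label a b c d e W Z A = 5} =
      {A \<in> ?V. {1, c, e} \<subseteq> A \<and> A \<inter> insert a (insert b (insert d (W \<union> Z))) = {}}"
    unfolding inner_label_def by (auto split: if_splits)
  show "N 0 = (n - 2 - card W) choose (r - 2)"
    unfolding N_def eq by (rule card_kneser_between[where p = 2 and q = "card W"]) (use r in \<open>simp_all add: simps\<close>)
  show "N 1 = (n - 4 - card W) choose (r - 3)"
    unfolding N_def eq by (rule card_kneser_between[where p = 3 and q = "card W + 1"]) (use r in \<open>simp_all add: simps\<close>)
  show "N 2 = (n - 5 - card W) choose (r - 3)"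
    unfolding N_def eq by (rule card_kneser_between[where p = 3 and q = "card W + 2"]) (use r in \<open>simp_all add: simps\<close>)
  show "N 3 = (n - 5 - card W) choose (r - 2)"
    unfolding N_def eq by (rule card_kneser_between[where p = 2 and q = "card W + 3"]) (use r in \<open>simp_all add: simps\<close>)
  show "N 4 = (n - 5 - card W - card Z) choose (r - 3)"
    unfolding N_def eq by (rule card_kneser_between[where p = 3 and q = "card W + card Z + 2"]) (use r in \<open>simp_all add: simps cardWZ\<close>)
  show "N 5 = (n - 6 - card W - card Z) choose (r - 3)"
    unfolding N_def eq by (rule card_kneser_between[where p = 3 and q = "card W + card Z + 3"]) (use r in \<open>simp_all add: simps cardWZ\<close>)
qed

lemma card_outer_label:
  assumes X: "{1, a, b, c, d} \<union> W \<subseteq> {1..n}"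
    and dist: "distinct [1, a, b, c, d]" "{1, a, b, c, d} \<inter> W = {}"
    and r: "3 \<le> r"
  defines "N i \<equiv> card {A \<in> pverts (kneser n r). outer_label a b c d W A = i}"
  shows "N 0 = (n - 4 - card W) choose (r - 1)"
    and "N 1 = (n - 5 - card W) choose (r - 2)"
    and "N 2 = (n - 5 - card W) choose (r - 3)"
    and "N 3 = (n - 5 - card W) choose (r - 2)"
    and "N 4 = (n - 5 - card W) choose (r - 3)"
    and "N 5 = (n - 4 - card W) choose (r - 3)"
proof -
  let ?V = "pverts (kneser n r)"
  have "finite W" by (rule finite_subset[of _ "{1..n}"]) (use X in blast, simp)
  note simps = X[simplified] dist(1)[simplified] dist(2)[simplified] this
  have eq: "{A \<in> ?V. outer_label a b c d W A = 0} = {A \<in> ?V. {a} \<subseteq> A \<and> A \<inter> insert 1 (insert b (insert c W)) = {}}"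
    "{A \<in> ?V. outer_label a b c d W A = 1} = {A \<in> ?V. {a, c} \<subseteq> A \<and> A \<inter> insert 1 (insert b (insert d W)) = {}}"
    "{A \<in> ?V. outer_label a b c d W A = 2} = {A \<in> ?V. {a, c, d} \<subseteq> A \<and> A \<inter> insert 1 (insert b W) = {}}"
    "{A \<in> ?V. outer_label a b c d W A = 3} = {A \<in> ?V. {a, b} \<subseteq> A \<and> A \<inter> insert 1 (insert c (insert d W)) = {}}"
    "{A \<in> ?V. outer_label a b c d W A = 4} = {A \<in> ?V. {a, b, d} \<subseteq> A \<and> A \<inter> insert 1 (insert c W) = {}}"
    "{A \<in> ?V. outer_label a b c d W A = 5} = {A \<in> ?V. {a, b, c} \<subseteq> A \<and> A \<inter> insert 1 W = {}}"
    unfolding outer_label_def by (auto split: if_splits)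
  show "N 0 = (n - 4 - card W) choose (r - 1)"
    unfolding N_def eq by (rule card_kneser_between[where p = 1 and q = "card W + 3"]) (use r in \<open>simp_all add: simps\<close>)
  show "N 1 = (n - 5 - card W) choose (r - 2)"
    unfolding N_def eq by (rule card_kneser_between[where p = 2 and q = "card W + 3"]) (use r in \<open>simp_all add: simps\<close>)
  show "N 2 = (n - 5 - card W) choose (r - 3)"
    unfolding N_def eq by (rule card_kneser_between[where p = 3 and q = "card W + 2"]) (use r in \<open>simp_all add: simps\<close>)
  show "N 3 = (n - 5 - card W) choose (r - 2)"
    unfolding N_def eq by (rule card_kneser_between[where p = 2 and q = "card W + 3"]) (use r in \<open>simp_all add: simps\<close>)
  show "N 4 = (n - 5 - card W) choose (r - 3)"
    unfolding N_def eq by (rule card_kneser_between[where p = 3 and q = "card W + 2"]) (use r in \<open>simp_all add: simps\<close>)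
  show "N 5 = (n - 4 - card W) choose (r - 3)"
    unfolding N_def eq by (rule card_kneser_between[where p = 3 and q = "card W + 1"]) (use r in \<open>simp_all add: simps\<close>)
qed

lemma less_6_cases:
  fixes i :: nat
  assumes "i < 6"
  obtains "i = 0" | "i = 1" | "i = 2" | "i = 3" | "i = 4" | "i = 5"
  using assms by linarith

text \<open>Blocks 0 and 1 are compared through \<open>big\<close>, the outer block having one more
  free point. The other blocks have equally many free points on both sides, and the inner one has at
  least as many forbidden points. In block 5 the point \<open>c\<close> alone would ensure
  intersection; requiring \<open>e\<close> as well brings the inner block down to order
  \<open>n ^ (r - 3)\<close>.\<close>

lemma card_inner_label_le_outer_label:
  assumes X: "{1, a, b, c, d, e} \<union> W \<union> Z \<subseteq> {1..n}"
    and dist: "distinct [1, a, b, c, d, e]" "{1, a, b, c, d, e} \<inter> (W \<union> Z) = {}" "W \<inter> Z = {}"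
    and W': "W' \<subseteq> W" "card W' \<le> 1" and r: "3 \<le> r"
    and big: "(n - 2) choose (r - 2) \<le> (n - 5) choose (r - 1)" "(n - 4) choose (r - 3) \<le> (n - 6) choose (r - 2)"
    and i: "i < 6"
  shows "card {A \<in> pverts (kneser n r). inner_label a b c d e W Z A = i}
    \<le> card {A \<in> pverts (kneser n r). outer_label a b c d W' A = i}"
proof -
  have "finite W" by (rule finite_subset[of _ "{1..n}"]) (use X in blast, simp)
  then have W: "card W' \<le> card W" using W'(1) by (simp add: card_mono)
  have "{1, a, b, c, d} \<union> W' \<subseteq> {1..n}" "distinct [1, a, b, c, d]" "{1, a, b, c, d} \<inter> W' = {}"
    using X dist W'(1) by auto
  note out = card_outer_label[OF this r] and inn = card_inner_label[OF X dist r]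
  have mono: "x choose k \<le> y choose k" if "x \<le> y" for x y k :: nat
    using that by (rule binomial_right_mono)
  from i show ?thesis
  proof (cases rule: less_6_cases)
    case 1
    have "(n - 2 - card W) choose (r - 2) \<le> (n - 2) choose (r - 2)" by (rule mono) simp
    also note big(1)
    also have "(n - 5) choose (r - 1) \<le> (n - 4 - card W') choose (r - 1)" by (rule mono) (use W'(2) in simp)
    finally show ?thesis unfolding 1 inn out .
  next
    case 2
    have "(n - 4 - card W) choose (r - 3) \<le> (n - 4) choose (r - 3)" by (rule mono) simp
    also note big(2)
    also have "(n - 6) choose (r - 2) \<le> (n - 5 - card W') choose (r - 2)" by (rule mono) (use W'(2) in simp)
    finally show ?thesis unfolding 2 inn out .
  next
    case 3
    show ?thesis unfolding 3 inn out by (rule mono) (use W in simp)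
  next
    case 4
    show ?thesis unfolding 4 inn out by (rule mono) (use W in simp)
  next
    case 5
    show ?thesis unfolding 5 inn out by (rule mono) (use W in simp)
  next
    case 6
    show ?thesis unfolding 6 inn out by (rule mono) (use W in simp)
  qed
qed

lemma card_inner_label_less:
  assumes X: "{1, a, b, c, d, e} \<union> W \<union> Z \<subseteq> {1..n}"
    and dist: "distinct [1, a, b, c, d, e]" "{1, a, b, c, d, e} \<inter> (W \<union> Z) = {}" "W \<inter> Z = {}"
    and r: "3 \<le> r"
  shows "card {A \<in> pverts (kneser n r). inner_label a b c d e W Z A < 6} =
    ((n - 2 - card W) choose (r - 2)) + ((n - 4 - card W) choose (r - 3)) + ((n - 5 - card W) choose (r - 3)) +
    ((n - 5 - card W) choose (r - 2)) + ((n - 5 - card W - card Z) choose (r - 3)) +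
    ((n - 6 - card W - card Z) choose (r - 3))"
proof -
  let ?V = "pverts (kneser n r)" and ?p = "inner_label a b c d e W Z"
  have "{A \<in> ?V. ?p A < 6} = {A \<in> ?V. ?p A \<in> {0, 1, 2, 3, 4, 5}}" by auto
  also have "card \<dots> = (\<Sum>i\<in>{0, 1, 2, 3, 4, 5}. card {A \<in> ?V. ?p A = i})"
    by (rule card_labels[OF finite_pverts_kneser]) simp
  finally show ?thesis using card_inner_label[OF assms] by simp
qed

lemma bandwidth_kneser_le:
  assumes r: "4 \<le> r" and n: "10 \<le> n"
    and big: "(n - 2) choose (r - 2) \<le> (n - 5) choose (r - 1)" "(n - 4) choose (r - 3) \<le> (n - 6) choose (r - 2)"
    and s: "s = ((n - 2) choose (r - 2)) + ((n - 4) choose (r - 3)) + ((n - 5) choose (r - 3)) +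
      ((n - 5) choose (r - 2)) + ((n - 7) choose (r - 3)) + ((n - 8) choose (r - 3))"
    and s': "s' = ((n - 4) choose (r - 2)) + ((n - 6) choose (r - 3)) + ((n - 7) choose (r - 3)) +
      ((n - 7) choose (r - 2)) + ((n - 8) choose (r - 3)) + ((n - 9) choose (r - 3))"
    and k: "s + s' \<le> \<kappa>" "\<kappa> \<le> (n - 1) choose (r - 1)" "2 * \<kappa> \<le> ((n - 1) choose (r - 1)) + s + s'"
  shows "bandwidth (kneser n r) \<le> (n choose r) - \<kappa> - 1"
proof -
  \<comment> \<open>The set \<open>{2, 3}\<close> keeps the primed inner blocks away from sets
    through \<open>2\<close> or \<open>3\<close>. The inner blocks 4 and 5 avoid \<open>4\<close>
    and \<open>5\<close> and contain \<open>6\<close>, which the primed blocks 4 and 5 avoid. Outer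
    blocks contain \<open>2\<close>, primed outer blocks do not.\<close>
  let ?p = "inner_label 2 3 6 7 8 {} {4, 5}" and ?q = "outer_label 2 3 6 7 {}"
  let ?p' = "inner_label 4 5 8 9 10 {2, 3} {6}" and ?q' = "outer_label 4 5 8 9 {2}"
  let ?V = "pverts (kneser n r)"
  define U where "U = {A \<in> ?V. {1} \<subseteq> A \<and> A \<inter> {} = {}}"
  have cardU: "card U = (n - 1) choose (r - 1)"
    unfolding U_def by (rule card_kneser_between[where p = 1 and q = 0]) (use n r in simp_all)
  have X: "{1, 2, 3, 6, 7, 8} \<union> {} \<union> {4, 5} \<subseteq> {1..n}" "{1, 4, 5, 8, 9, 10} \<union> {2, 3} \<union> {6} \<subseteq> {1..n}"
    using n by auto
  have dist: "distinct [1, 2, 3, 6, 7, 8 :: nat]" "{1, 2, 3, 6, 7, 8 :: nat} \<inter> ({} \<union> {4, 5}) = {}" "{} \<inter> {4, 5 :: nat} = {}"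
    by auto
  have dist': "distinct [1, 4, 5, 8, 9, 10 :: nat]" "{1, 4, 5, 8, 9, 10 :: nat} \<inter> ({2, 3} \<union> {6}) = {}" "{2, 3} \<inter> {6 :: nat} = {}"
    by auto
  have r3: "3 \<le> r" using r by simp
  have "bandwidth (kneser n r) \<le> card ?V - \<kappa> - 1"
  proof (rule bandwidth_le_of_blocks[where U = U and p = ?p and q = ?q and p' = ?p' and q' = ?q' and m = 6])
    show "finite ?V" by (rule finite_pverts_kneser)
    show "u \<in> ?V \<and> v \<in> ?V \<and> (v, u) \<in> parcs (kneser n r)" if "(u, v) \<in> parcs (kneser n r)" for u v
      using that unfolding parcs_kneser by blast
    show "U \<subseteq> ?V" unfolding U_def by blast
    show "(u, v) \<notin> parcs (kneser n r)" if "u \<in> U" "v \<in> U" for u v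
      using that unfolding U_def parcs_kneser by blast
    show "v \<in> U \<and> 6 \<le> ?p' v" if "v \<in> ?V" "?p v < 6" for v
      using that unfolding U_def inner_label_def by (auto split: if_splits)
    show "v \<in> U" if "v \<in> ?V" "?p' v < 6" for v
      using that unfolding U_def inner_label_def by (auto split: if_splits)
    show "v \<notin> U \<and> 6 \<le> ?q' v" if "v \<in> ?V" "?q v < 6" for v
      using that unfolding U_def outer_label_def by (auto split: if_splits)
    show "v \<notin> U" if "v \<in> ?V" "?q' v < 6" for v
      using that unfolding U_def outer_label_def by (auto split: if_splits)
    show "?q u < ?p v" if "(u, v) \<in> parcs (kneser n r)" "?q u < 6" for u v
      by (rule outer_label_less_inner_label) (use that in \<open>auto simp: parcs_kneser\<close>)
    show "?q' u < ?p' v" if "(u, v) \<in> parcs (kneser n r)" "?q' u < 6" for u v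
      by (rule outer_label_less_inner_label) (use that in \<open>auto simp: parcs_kneser\<close>)
    show "card {v \<in> ?V. ?p v = i} \<le> card {v \<in> ?V. ?q v = i}" if "i < 6" for i
      by (rule card_inner_label_le_outer_label[OF X(1) dist _ _ r3 big that]) auto
    show "card {v \<in> ?V. ?p' v = i} \<le> card {v \<in> ?V. ?q' v = i}" if "i < 6" for i
      by (rule card_inner_label_le_outer_label[OF X(2) dist' _ _ r3 big that]) auto
    show "s = card {v \<in> ?V. ?p v < 6}"
      unfolding s by (subst card_inner_label_less[OF X(1) dist r3]) simp
    show "s' = card {v \<in> ?V. ?p' v < 6}"
      unfolding s' by (subst card_inner_label_less[OF X(2) dist' r3]) simp
  qed (use k cardU in simp_all)
  then show ?thesis unfolding card_pverts_kneser .
qed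

section \<open>From arrangements to sequences\<close>

lemma dilation_ge:
  assumes "finite (parcs G)" "(u, v) \<in> parcs G"
  shows "nat \<bar>int (f u) - int (f v)\<bar> \<le> dilation G f"
proof -
  have "{nat \<bar>int (f v) - int (f w)\<bar> | v w. (v, w) \<in> parcs G} =
      (\<lambda>(v, w). nat \<bar>int (f v) - int (f w)\<bar>) ` parcs G" by auto
  then have "finite {nat \<bar>int (f v) - int (f w)\<bar> | v w. (v, w) \<in> parcs G}"
    using assms(1) by simp
  then show ?thesis unfolding dilation_def by (intro Max_ge) (use assms(2) in auto)
qed

text \<open>From \<open>r * (n choose r) = n * ((n - 1) choose (r - 1))\<close>. It guarantees that
  two ends no longer than a star do not overlap.\<close>

lemma two_stars_le_binomial:
  assumes "1 \<le> r" "2 * r \<le> n"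
  shows "2 * ((n - 1) choose (r - 1)) \<le> n choose r"
proof -
  have "Suc (r - 1) * (Suc (n - 1) choose Suc (r - 1)) = Suc (n - 1) * ((n - 1) choose (r - 1))"
    by (rule Suc_times_binomial)
  then have "r * (n choose r) = n * ((n - 1) choose (r - 1))" using assms by simp
  also have "\<dots> \<ge> 2 * r * ((n - 1) choose (r - 1))" using assms(2) by (intro mult_right_mono) auto
  finally have "r * (2 * ((n - 1) choose (r - 1))) \<le> r * (n choose r)" by (simp add: mult_ac)
  then show ?thesis using assms(1) by simp
qed

lemma bandwidth_kneser_ge:
  assumes r: "4 \<le> r" and n: "r + 5 \<le> n" "2 * r \<le> n"
    and big: "3 * ((n - 2) choose (r - 2)) + 4 * r\<^sup>2 * n ^ (r - 3) + ((n - 5) choose (r - 1)) \<le> (n - 1) choose (r - 1)"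
      "4 * (r\<^sup>2 * n ^ (r - 2)) + 2 \<le> (n - 1) choose (r - 1)"
      "2 * (2 * ((n - 4) choose (r - 3)) + 2 * r\<^sup>2 * n ^ (r - 4) + 1) + 2 < (n - 5) choose (r - 1)"
  shows "2 * (n choose r) + ((n - 5) choose (r - 1)) \<le> 2 * bandwidth (kneser n r) + 2 * ((n - 1) choose (r - 1)) +
    2 * (2 * ((n - 4) choose (r - 3)) + 2 * r\<^sup>2 * n ^ (r - 4) + 1) + 2"
proof -
  let ?V = "pverts (kneser n r)" and ?N = "n choose r"
  obtain f where f: "bij_betw f ?V {1..?N}" and D: "bandwidth (kneser n r) = dilation (kneser n r) f"
    using bandwidth_attained[OF finite_pverts_kneser] unfolding card_pverts_kneser by blast
  define g where "g = inv_into ?V f"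
  have g: "bij_betw g {1..?N} ?V" unfolding g_def by (rule bij_betw_inv_into[OF f])
  have fg: "f (g i) = i" if "i \<in> {1..?N}" for i
    unfolding g_def using bij_betw_inv_into_right[OF f that] .
  have gV: "g i \<in> ?V" if "i \<in> {1..?N}" for i using g that by (rule bij_betwE[rule_format])
  have inj: "inj_on g {1..?N}" using g by (rule bij_betw_imp_inj_on)
  \<comment> \<open>The cap by the star size keeps the two ends disjoint; the length bound shows
    afterwards that \<open>k\<close> stays strictly below the cap.\<close>
  define k where "k = min (?N - bandwidth (kneser n r)) ((n - 1) choose (r - 1))"
  have "2 * ((n - 1) choose (r - 1)) \<le> ?N" using two_stars_le_binomial n(2) r by simp
  then have k2: "2 * k \<le> ?N" unfolding k_def by simp
  define B where "B j = g (?N + 1 - j)" for j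
  have range: "i \<in> {1..?N}" "?N + 1 - i \<in> {1..?N}" if "i \<in> {1..<k}" for i
    using that k2 by auto
  interpret cross_sequences "{1..n}" r k g B
  proof
    show "finite {1..n}" by simp
    show "g i \<subseteq> {1..n} \<and> card (g i) = r" if "i \<in> {1..<k}" for i
      using gV[OF range(1)[OF that]] by (simp add: pverts_kneser)
    show "B i \<subseteq> {1..n} \<and> card (B i) = r" if "i \<in> {1..<k}" for i
      using gV[OF range(2)[OF that]] by (simp add: pverts_kneser B_def)
    show "inj_on g {1..<k}" by (rule inj_on_subset[OF inj]) (use range(1) in blast)
    show "inj_on B {1..<k}"
    proof (rule inj_onI)
      fix i j assume ij: "i \<in> {1..<k}" "j \<in> {1..<k}" "B i = B j"
      then have "?N + 1 - i = ?N + 1 - j"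
        unfolding B_def using inj_onD[OF inj _ range(2)[OF ij(1)] range(2)[OF ij(2)]] by simp
      then show "i = j" using range(1)[OF ij(1)] range(1)[OF ij(2)] by auto
    qed
    show "g i \<noteq> B j" if ij: "i \<in> {1..<k}" "j \<in> {1..<k}" for i j
    proof
      assume "g i = B j"
      then have "i = ?N + 1 - j"
        unfolding B_def using inj_onD[OF inj _ range(1)[OF ij(1)] range(2)[OF ij(2)]] by simp
      then show False using ij k2 by auto
    qed
    show "g i \<inter> B j \<noteq> {}" if ij: "1 \<le> i" "1 \<le> j" "i + j \<le> k" for i j
    proof
      assume "g i \<inter> B j = {}"
      have mem: "i \<in> {1..?N}" "?N + 1 - j \<in> {1..?N}" using ij k2 by auto
      have "(g i, B j) \<in> parcs (kneser n r)"
        using gV[OF mem(1)] gV[OF mem(2)] \<open>g i \<inter> B j = {}\<close> unfolding parcs_kneser B_def by blast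
      moreover have "finite (parcs (kneser n r))"
        by (rule finite_subset[of _ "?V \<times> ?V"]) (auto simp: parcs_kneser finite_pverts_kneser)
      ultimately have "nat \<bar>int (f (g i)) - int (f (B j))\<bar> \<le> bandwidth (kneser n r)"
        unfolding D by (rule dilation_ge[rotated])
      then have "nat \<bar>int i - int (?N + 1 - j)\<bar> \<le> bandwidth (kneser n r)"
        unfolding B_def fg[OF mem(1)] fg[OF mem(2)] .
      \<comment> \<open>The two positions differ by \<open>?N + 1 - i - j\<close>, which exceeds the
        bandwidth.\<close>
      moreover have "i + j \<le> ?N - bandwidth (kneser n r)" using ij(3) unfolding k_def by simp
      ultimately show False using ij mem by auto
    qed
  qed
  define e where "e = 2 * (2 * ((n - 4) choose (r - 3)) + 2 * r\<^sup>2 * n ^ (r - 4) + 1)"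
  have le: "(n - 5) choose (r - 1) \<le> (n - 1) choose (r - 1)" by (rule binomial_right_mono) simp
  have "2 * k + ((n - 5) choose (r - 1)) \<le> 2 * ((n - 1) choose (r - 1)) + e + 2"
  proof (cases "2 * (r\<^sup>2 * n ^ (r - 2)) + 1 < k")
    case True
    have "n = card {1..n}" by simp
    from length_bound[OF r this n(1) True big(1)] show ?thesis unfolding e_def by linarith
  next
    case False
    then show ?thesis using le big(2) by linarith
  qed
  moreover from this have "k < (n - 1) choose (r - 1)" using big(3) unfolding e_def[symmetric] by linarith
  then have "k = ?N - bandwidth (kneser n r)" unfolding k_def by simp
  ultimately show ?thesis unfolding e_def by linarith
qed

section \<open>Asymptotics of binomial coefficients\<close>

lemma power_bigo_power: "a \<le> b \<Longrightarrow> (\<lambda>n. real n ^ a) \<in> O(\<lambda>n. real n ^ b)"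
  by (rule bigoI[where c = 1], rule eventually_mono[OF eventually_ge_at_top[of 1]])
    (simp add: power_increasing)

lemma binomial_eq_prod:
  assumes "a + j \<le> n"
  shows "real ((n - a) choose j) = (\<Prod>i<j. real n - (real a + real i)) / fact j"
proof -
  have "real ((n - a) choose j) = real (n - a) gchoose j" by (rule binomial_gbinomial)
  also have "\<dots> = (\<Prod>i<j. real n - (real a + real i)) / fact j"
    using assms by (simp add: gbinomial_prod_rev atLeast0LessThan of_nat_diff algebra_simps)
  finally show ?thesis .
qed

text \<open>Each further factor \<open>real n - d\<close> raises the error by one degree and adds
  \<open>d\<close> to the second coefficient. Writing the degree as \<open>Suc (Suc m)\<close>
  avoids truncated exponents.\<close>

lemma prod_linear_expansion:
  fixes c :: "nat \<Rightarrow> real"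
  shows "(\<lambda>n. (\<Prod>i<Suc (Suc m). real n - c i) -
    (real n ^ Suc (Suc m) - (\<Sum>i<Suc (Suc m). c i) * real n ^ Suc m)) \<in> O(\<lambda>n. real n ^ m)"
proof (induction m)
  case 0
  have "(\<lambda>n. (\<Prod>i<Suc (Suc 0). real n - c i) - (real n ^ Suc (Suc 0) - (\<Sum>i<Suc (Suc 0). c i) * real n ^ Suc 0))
      = (\<lambda>n. c 0 * c 1)"
    by (rule ext) (simp add: algebra_simps power2_eq_square)
  then show ?case by simp
next
  case (Suc m)
  define P where "P n = (\<Prod>i<Suc (Suc m). real n - c i)" for n :: nat
  define s where "s = (\<Sum>i<Suc (Suc m). c i)"
  define d where "d = c (Suc (Suc m))"
  define E where "E n = P n - (real n ^ Suc (Suc m) - s * real n ^ Suc m)" for n :: nat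
  have E: "E \<in> O(\<lambda>n. real n ^ m)" using Suc unfolding E_def P_def s_def .
  have P: "P n = E n + (real n ^ Suc (Suc m) - s * real n ^ Suc m)" for n by (simp add: E_def)
  have "(\<Prod>i<Suc (Suc (Suc m)). real n - c i) -
      (real n ^ Suc (Suc (Suc m)) - (\<Sum>i<Suc (Suc (Suc m)). c i) * real n ^ Suc (Suc m)) =
      E n * real n - d * E n + d * s * real n ^ Suc m" for n
  proof -
    have "(\<Prod>i<Suc (Suc (Suc m)). real n - c i) = P n * (real n - d)"
      "(\<Sum>i<Suc (Suc (Suc m)). c i) = s + d" unfolding P_def s_def d_def by simp_all
    then show ?thesis unfolding P by (simp add: algebra_simps)
  qed
  moreover have "(\<lambda>n. E n * real n) \<in> O(\<lambda>n. real n ^ Suc m)"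
    using landau_o.big.mult[OF E, of "\<lambda>n. real n" "\<lambda>n. real n"] by (simp add: mult.commute)
  moreover have "(\<lambda>n. d * E n) \<in> O(\<lambda>n. real n ^ Suc m)"
    using landau_o.big_trans[OF E power_bigo_power[of m "Suc m"]] by simp
  moreover have "(\<lambda>n. d * s * real n ^ Suc m) \<in> O(\<lambda>n. real n ^ Suc m)" by simp
  ultimately show ?case by (simp only:) (intro sum_in_bigo)
qed

lemma binomial_expansion:
  assumes "2 \<le> j"
  shows "(\<lambda>n. real ((n - a) choose j) - (real n ^ j / fact j -
    (real a + (real j - 1) / 2) * (real n ^ (j - 1) / fact (j - 1)))) \<in> O(\<lambda>n. real n ^ (j - 2))"
proof -
  obtain m where j: "j = Suc (Suc m)" using assms by (metis add_2_eq_Suc le_Suc_ex)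
  have sum: "(\<Sum>i<j. real a + real i) = real j * (real a + (real j - 1) / 2)" for j
    by (induction j) (simp_all add: field_simps)
  define F where "F n = (\<Prod>i<j. real n - (real a + real i)) -
      (real n ^ j - (\<Sum>i<j. real a + real i) * real n ^ (j - 1))" for n :: nat
  have "F \<in> O(\<lambda>n. real n ^ (j - 2))"
    using prod_linear_expansion[where m = m and c = "\<lambda>i. real a + real i"] unfolding F_def j by simp
  then have "(\<lambda>n. F n / fact j) \<in> O(\<lambda>n. real n ^ (j - 2))" by simp
  moreover have "\<forall>\<^sub>F n in sequentially. F n / fact j = real ((n - a) choose j) - (real n ^ j / fact j -
    (real a + (real j - 1) / 2) * (real n ^ (j - 1) / fact (j - 1)))"
  proof (rule eventually_mono[OF eventually_ge_at_top[of "a + j"]])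
    fix n assume "a + j \<le> n"
    \<comment> \<open>The shifts sum to \<open>j\<close> times their mean, and this \<open>j\<close>
      cancels against the factorial.\<close>
    have "fact j = real j * fact (j - 1)" unfolding j by (simp add: fact_Suc del: of_nat_Suc)
    moreover have "real j \<noteq> 0" unfolding j by simp
    ultimately show "F n / fact j = real ((n - a) choose j) - (real n ^ j / fact j -
        (real a + (real j - 1) / 2) * (real n ^ (j - 1) / fact (j - 1)))"
      unfolding binomial_eq_prod[OF \<open>a + j \<le> n\<close>] F_def sum by (simp add: diff_divide_distrib)
  qed
  ultimately show ?thesis using landau_o.big.in_cong by fast
qed

lemma binomial_leading:
  assumes "1 \<le> j"
  shows "(\<lambda>n. real ((n - a) choose j) - real n ^ j / fact j) \<in> O(\<lambda>n. real n ^ (j - 1))"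
proof (cases "j = 1")
  case True
  \<comment> \<open>The two-term expansion needs degree at least 2; degree 1 does occur, as
    \<open>r - 3\<close> for \<open>r = 4\<close>.\<close>
  have "\<forall>\<^sub>F n in sequentially. - real a = real ((n - a) choose j) - real n ^ j / fact j"
    by (rule eventually_mono[OF eventually_ge_at_top[of a]]) (simp add: True)
  moreover have "(\<lambda>n. - real a) \<in> O(\<lambda>n. real n ^ (j - 1))" using True by simp
  ultimately show ?thesis using landau_o.big.in_cong by fast
next
  case False
  then have "2 \<le> j" using assms by simp
  define q where "q = (real a + (real j - 1) / 2) / fact (j - 1)"
  have "(\<lambda>n. real ((n - a) choose j) - (real n ^ j / fact j - q * real n ^ (j - 1))) \<in> O(\<lambda>n. real n ^ (j - 1))"
    using landau_o.big_trans[OF binomial_expansion[OF \<open>2 \<le> j\<close>, of a] power_bigo_power[of "j - 2" "j - 1"]]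
    by (simp add: q_def)
  moreover have "(\<lambda>n. q * real n ^ (j - 1)) \<in> O(\<lambda>n. real n ^ (j - 1))" by simp
  ultimately have "(\<lambda>n. (real ((n - a) choose j) - (real n ^ j / fact j - q * real n ^ (j - 1))) - q * real n ^ (j - 1))
      \<in> O(\<lambda>n. real n ^ (j - 1))" by (rule sum_in_bigo)
  then show ?thesis by simp
qed

lemma binomial_bigo: "(\<lambda>n. real ((n - a) choose j)) \<in> O(\<lambda>n. real n ^ j)"
proof (rule bigoI[where c = 1], rule always_eventually, rule allI)
  fix n :: nat
  have "real ((n - a) choose j) \<le> real (n ^ j)" using choose_le_pow[of "n - a" n j] by (simp only: of_nat_le_iff)
  then show "norm (real ((n - a) choose j)) \<le> 1 * norm (real n ^ j)" by simp
qed

lemma eventually_less_binomial: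
  assumes "f \<in> O(\<lambda>n. real n ^ j)"
  shows "\<forall>\<^sub>F n in sequentially. f n < real ((n - a) choose Suc j)"
proof -
  define g where "g n = f n - (real ((n - a) choose Suc j) - real n ^ Suc j / fact (Suc j))" for n
  have "(\<lambda>n. real ((n - a) choose Suc j) - real n ^ Suc j / fact (Suc j)) \<in> O(\<lambda>n. real n ^ j)"
    using binomial_leading[of "Suc j" a] by simp
  from sum_in_bigo(2)[OF assms this] have "g \<in> O(\<lambda>n. real n ^ j)" unfolding g_def .
  then obtain K where K: "\<forall>\<^sub>F n in sequentially. norm (g n) \<le> K * norm (real n ^ j)"
    by (auto elim: landau_o.bigE)
  have "\<forall>\<^sub>F n in sequentially. K * fact (Suc j) < real n"
    using filterlim_at_top_dense filterlim_real_sequentially by blast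
  with K eventually_gt_at_top[of 0] show ?thesis
  proof eventually_elim
    case (elim n)
    have "g n \<le> K * real n ^ j" using elim(1) by simp
    also have "\<dots> < real n / fact (Suc j) * real n ^ j"
      using elim(2,3) by (intro mult_strict_right_mono) (simp_all add: pos_less_divide_eq del: fact_Suc)
    finally show ?case unfolding g_def by simp
  qed
qed

lemma eventually_less_binomial_nat:
  assumes "(\<lambda>n. real (f n)) \<in> O(\<lambda>n. real n ^ j)" "k = Suc j"
  shows "\<forall>\<^sub>F n in sequentially. f n < (n - a) choose k"
  using eventually_less_binomial[OF assms(1), of a] unfolding assms(2) by (simp only: of_nat_less_iff)

lemma binomial_pascal_diff:
  assumes "i < n" "1 \<le> k" "m = Suc i" "l = k - 1"
  shows "(n - i) choose k = ((n - m) choose l) + ((n - m) choose k)"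
proof -
  obtain m' l' where "n - i = Suc m'" "k = Suc l'"
    using assms by (metis Suc_diff_Suc Suc_le_D One_nat_def)
  moreover from this have "n - m = m'" "l = l'" using assms(3,4) by simp_all
  ultimately show ?thesis by simp
qed

text \<open>Four applications of Pascal's rule: sets through one point are sorted by the first of
  four further points that they contain.\<close>

lemma star_minus_star:
  assumes "5 \<le> n" "2 \<le> r"
  shows "(n - 1) choose (r - 1) = ((n - 2) choose (r - 2)) + ((n - 3) choose (r - 2)) + ((n - 4) choose (r - 2)) +
    ((n - 5) choose (r - 2)) + ((n - 5) choose (r - 1))"
proof -
  have "(n - 1) choose (r - 1) = ((n - 2) choose (r - 2)) + ((n - 2) choose (r - 1))"
    "(n - 2) choose (r - 1) = ((n - 3) choose (r - 2)) + ((n - 3) choose (r - 1))"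
    "(n - 3) choose (r - 1) = ((n - 4) choose (r - 2)) + ((n - 4) choose (r - 1))"
    "(n - 4) choose (r - 1) = ((n - 5) choose (r - 2)) + ((n - 5) choose (r - 1))"
    by (rule binomial_pascal_diff; use assms in simp)+
  then show ?thesis by linarith
qed

section \<open>The bandwidth\<close>

theorem theorem1p1:
  fixes r :: nat
  assumes "r \<ge> 4"
  shows "(\<lambda>n::nat. real (bandwidth (kneser n r)) -
      (real (n choose r) - 1 / 2 * real ((n - 1) choose (r - 1))
        - 2 * (real n ^ (r - 2) / fact (r - 2))
        + (real r + 2) * (real n ^ (r - 3) / fact (r - 3))))
    \<in> O(\<lambda>n. real n ^ (r - 4))"
proof -
  define x where "x n = real n ^ (r - 2) / fact (r - 2)" for n
  define y where "y n = real n ^ (r - 3) / fact (r - 3)" for n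
  define S where "S a n = real ((n - a) choose (r - 2)) - (x n - (real a + (real r - 3) / 2) * y n)" for a n
  define T where "T a n = real ((n - a) choose (r - 3)) - y n" for a n
  have r: "real (r - 2) = real r - 2" "r - 2 - 1 = r - 3" "r - 2 - 2 = r - 4" "r - 3 - 1 = r - 4"
    using assms by auto
  have S: "S a \<in> O(\<lambda>n. real n ^ (r - 4))" for a
    using binomial_expansion[of "r - 2" a] assms unfolding S_def x_def y_def r by (simp add: algebra_simps)
  have T: "T a \<in> O(\<lambda>n. real n ^ (r - 4))" for a
    using binomial_leading[of "r - 3" a] assms unfolding T_def y_def r by simp

  define s where "s n = ((n - 2) choose (r - 2)) + ((n - 4) choose (r - 3)) + ((n - 5) choose (r - 3)) +
      ((n - 5) choose (r - 2)) + ((n - 7) choose (r - 3)) + ((n - 8) choose (r - 3))" for n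
  define s' where "s' n = ((n - 4) choose (r - 2)) + ((n - 6) choose (r - 3)) + ((n - 7) choose (r - 3)) +
      ((n - 7) choose (r - 2)) + ((n - 8) choose (r - 3)) + ((n - 9) choose (r - 3))" for n
  define e where "e n = 2 * (2 * ((n - 4) choose (r - 3)) + 2 * r\<^sup>2 * n ^ (r - 4) + 1) + 2" for n
  \<comment> \<open>This is twice the correction in the claim, since both bounds estimate twice the
    bandwidth.\<close>
  define main where "main n = 4 * x n - 2 * (real r + 2) * y n" for n

  define lower where "lower n = real (s n + s' n) - main n" for n
  \<comment> \<open>The second-order terms agree with those of \<open>upper\<close>: shifts
    \<open>2, 5, 4, 7\<close> sum to 18 and eight terms of order \<open>n ^ (r - 3)\<close> are
    added, while below \<open>2, 3, 4, 5\<close> sum to 14 and four are added. Each time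
    \<open>- 2 * (r + 2)\<close> copies of \<open>y\<close> result.\<close>
  have "lower = (\<lambda>n. (S 2 n + S 5 n + S 4 n + S 7 n) +
      (T 4 n + T 5 n + T 7 n + T 8 n) + (T 6 n + T 7 n + T 8 n + T 9 n))"
    by (rule ext) (simp add: lower_def main_def s_def s'_def S_def T_def field_simps)
  then have lower: "lower \<in> O(\<lambda>n. real n ^ (r - 4))" by (simp only:) (intro sum_in_bigo S T)

  define upper where "upper n = real (((n - 2) choose (r - 2)) + ((n - 3) choose (r - 2)) +
      ((n - 4) choose (r - 2)) + ((n - 5) choose (r - 2)) + e n) - main n" for n
  have "upper = (\<lambda>n. (S 2 n + S 3 n + S 4 n + S 5 n) + 4 * T 4 n + 4 * real r ^ 2 * real n ^ (r - 4) + 4)"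
    by (rule ext) (simp add: upper_def main_def e_def S_def T_def field_simps)
  moreover have "(\<lambda>n. 4) \<in> O(\<lambda>n. real n ^ (r - 4))" using power_bigo_power[of 0 "r - 4"] by simp
  moreover have "(\<lambda>n. 4 * real r ^ 2 * real n ^ (r - 4)) \<in> O(\<lambda>n. real n ^ (r - 4))" by simp
  moreover have "(\<lambda>n. 4 * T 4 n) \<in> O(\<lambda>n. real n ^ (r - 4))" using T by simp
  ultimately have upper: "upper \<in> O(\<lambda>n. real n ^ (r - 4))" by (simp only:) (intro sum_in_bigo S)

  \<comment> \<open>Inequalities that hold for all large \<open>n\<close>\<close>
  have bin: "(\<lambda>n. real ((n - a) choose i)) \<in> O(\<lambda>n. real n ^ j)" if "i \<le> j" for a i j
    using landau_o.big_trans[OF binomial_bigo power_bigo_power[OF that]] .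
  have pow: "(\<lambda>n. c * real n ^ i) \<in> O(\<lambda>n. real n ^ j)" if "i \<le> j" for c :: real and i j
    using power_bigo_power[OF that] by simp
  have const: "(\<lambda>n. c) \<in> O(\<lambda>n. real n ^ j)" for c :: real and j using pow[of 0 j c] by simp
  have ev1: "\<forall>\<^sub>F n in sequentially. (n - 2) choose (r - 2) < (n - 5) choose (r - 1)"
    by (rule eventually_less_binomial_nat[OF bin]) (use assms in auto)
  have ev2: "\<forall>\<^sub>F n in sequentially. (n - 4) choose (r - 3) < (n - 6) choose (r - 2)"
    by (rule eventually_less_binomial_nat[OF bin]) (use assms in auto)
  have ev3: "\<forall>\<^sub>F n in sequentially. s n + s' n < (n - 1) choose (r - 1)"
  proof (rule eventually_less_binomial_nat)
    show "(\<lambda>n. real (s n + s' n)) \<in> O(\<lambda>n. real n ^ (r - 2))"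
      unfolding s_def s'_def of_nat_add by (intro sum_in_bigo bin) simp_all
  qed (use assms in simp)
  have ev4: "\<forall>\<^sub>F n in sequentially. 3 * ((n - 2) choose (r - 2)) + 4 * r\<^sup>2 * n ^ (r - 3) <
      ((n - 2) choose (r - 2)) + ((n - 3) choose (r - 2)) + ((n - 4) choose (r - 2)) + ((n - 5) choose (r - 2))"
  proof -
    define D where "D a n = real ((n - a) choose (r - 2)) - x n" for a n
    have D: "D a \<in> O(\<lambda>n. real n ^ (r - 3))" for a
      using binomial_leading[of "r - 2" a] assms unfolding D_def x_def r by simp
    \<comment> \<open>After cancellation the claim compares \<open>2 - 1 - 1 = 0\<close> leading
      terms plus lower order with one full binomial coefficient.\<close>
    have "(\<lambda>n. 2 * D 2 n - D 3 n - D 4 n + 4 * real r ^ 2 * real n ^ (r - 3)) \<in> O(\<lambda>n. real n ^ (r - 3))"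
      by (intro sum_in_bigo pow D) (use D in simp_all)
    from eventually_less_binomial[OF this, of 5] show ?thesis
    proof eventually_elim
      case (elim n)
      have "Suc (r - 3) = r - 2" using assms by simp
      then have "real (3 * ((n - 2) choose (r - 2)) + 4 * r\<^sup>2 * n ^ (r - 3)) <
          real (((n - 2) choose (r - 2)) + ((n - 3) choose (r - 2)) + ((n - 4) choose (r - 2)) + ((n - 5) choose (r - 2)))"
        using elim unfolding D_def by simp
      then show ?case by (simp only: of_nat_less_iff)
    qed
  qed
  have ev5: "\<forall>\<^sub>F n in sequentially. 4 * (r\<^sup>2 * n ^ (r - 2)) + 2 < (n - 1) choose (r - 1)"
  proof (rule eventually_less_binomial_nat)
    have "(\<lambda>n. (4 * real r ^ 2) * real n ^ (r - 2) + 2) \<in> O(\<lambda>n. real n ^ (r - 2))"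
      by (intro sum_in_bigo pow const) simp
    then show "(\<lambda>n. real (4 * (r\<^sup>2 * n ^ (r - 2)) + 2)) \<in> O(\<lambda>n. real n ^ (r - 2))" by (simp add: algebra_simps)
  qed (use assms in simp)
  have ev6: "\<forall>\<^sub>F n in sequentially. e n < (n - 5) choose (r - 1)"
  proof (rule eventually_less_binomial_nat)
    have "(\<lambda>n. 4 * real ((n - 4) choose (r - 3)) + (4 * real r ^ 2) * real n ^ (r - 4) + 4) \<in> O(\<lambda>n. real n ^ (r - 2))"
      by (intro sum_in_bigo pow const) (use bin[of "r - 3" "r - 2" 4] in simp_all)
    then show "(\<lambda>n. real (e n)) \<in> O(\<lambda>n. real n ^ (r - 2))" by (simp add: e_def algebra_simps)
  qed (use assms in simp)

  \<comment> \<open>Combining the two bounds\<close>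
  have half: "\<bar>z\<bar> \<le> \<bar>p + q\<bar>" if "\<bar>2 * z\<bar> \<le> p + q" for z p q :: real using that by linarith
  have "\<forall>\<^sub>F n in sequentially. norm (real (bandwidth (kneser n r)) -
      (real (n choose r) - 1 / 2 * real ((n - 1) choose (r - 1)) - 2 * x n + (real r + 2) * y n))
      \<le> norm (\<bar>lower n\<bar> + \<bar>upper n\<bar>)"
    using ev1 ev2 ev3 ev4 ev5 ev6 eventually_ge_at_top[of "2 * r + 10"]
  proof eventually_elim
    case (elim n)
    define b where "b = bandwidth (kneser n r)"
    define u where "u = (n - 1) choose (r - 1)"
    define t where "t = (n - 5) choose (r - 1)"
    define d where "d = ((n - 2) choose (r - 2)) + ((n - 3) choose (r - 2)) +
      ((n - 4) choose (r - 2)) + ((n - 5) choose (r - 2))"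
    have n: "10 \<le> n" "r + 5 \<le> n" "2 * r \<le> n" "5 \<le> n" using elim(7) by auto
    have u: "u = d + t" unfolding u_def t_def d_def using star_minus_star[of n r] n assms by simp
    have "2 * (n choose r) + t \<le> 2 * b + 2 * u + e n"
      using bandwidth_kneser_ge[OF assms n(2,3)] elim(4-6) u
      unfolding b_def t_def[symmetric] u_def[symmetric] d_def[symmetric] e_def by (simp add: add.assoc)
    then have ge: "2 * real (n choose r) + real t \<le> 2 * real b + 2 * real u + real (e n)" by linarith
    \<comment> \<open>The largest value that \<open>bandwidth_kneser_le\<close> admits; the loss of
      at most one half by rounding is absorbed by the final \<open>- 1\<close> there.\<close>
    define \<kappa> where "\<kappa> = (u + s n + s' n) div 2"
    have k: "s n + s' n \<le> \<kappa>" "\<kappa> \<le> u" "2 * \<kappa> \<le> u + s n + s' n" "u + s n + s' n \<le> 2 * \<kappa> + 1" "0 < u"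
      using elim(3)[folded u_def] unfolding \<kappa>_def by linarith+
    have "b \<le> (n choose r) - \<kappa> - 1"
      unfolding b_def
      by (rule bandwidth_kneser_le[OF assms n(1) _ _ s_def s'_def])
        (use elim(1,2) k(1-3)[unfolded u_def] in linarith)+
    \<comment> \<open>This keeps the subtraction \<open>(n choose r) - \<kappa> - 1\<close> from
      being truncated at zero.\<close>
    moreover have "2 * u \<le> n choose r" unfolding u_def using two_stars_le_binomial[of r n] n assms by simp
    ultimately have "2 * b + u + (s n + s' n) \<le> 2 * (n choose r)" using k(2,4,5) by linarith
    then have le: "2 * real b + real u + real (s n + s' n) \<le> 2 * real (n choose r)" by linarith
    have "real (s n + s' n) = lower n + main n" "real d + real (e n) = upper n + main n"
      unfolding lower_def upper_def d_def by simp_all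
    with ge le u have "\<bar>2 * real b - (2 * real (n choose r) - real u - main n)\<bar> \<le> \<bar>lower n\<bar> + \<bar>upper n\<bar>" by simp
    also have "2 * real b - (2 * real (n choose r) - real u - main n) =
        2 * (real b - (real (n choose r) - 1 / 2 * real u - 2 * x n + (real r + 2) * y n))"
      unfolding main_def by (simp add: algebra_simps)
    finally show ?case unfolding b_def u_def real_norm_def by (rule half)
  qed
  then have "(\<lambda>n. real (bandwidth (kneser n r)) -
      (real (n choose r) - 1 / 2 * real ((n - 1) choose (r - 1)) - 2 * x n + (real r + 2) * y n))
      \<in> O(\<lambda>n. \<bar>lower n\<bar> + \<bar>upper n\<bar>)" by (intro landau_o.big_mono)
  also have "(\<lambda>n. \<bar>lower n\<bar> + \<bar>upper n\<bar>) \<in> O(\<lambda>n. real n ^ (r - 4))"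
    using lower upper by (intro sum_in_bigo) simp_all
  finally show ?thesis unfolding x_def y_def .
qed

end
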